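(* Emptiness is undecidable for real-time $\mathrm{SC\text{-}OCA}(n)$s and for real-time $\mathrm{MC\text{-}OCA}(\log n)$s accepting bounded languages: there is no algorithm that, given a real-time one-way cellular automaton $\mathcal M$ that is sum communication bounded by a function in $O(n)$ (respectively, max communication bounded by a function in $O(\log n)$) and accepts a bounded language, decides whether $L(\mathcal M)=\emptyset$.
   Context: A language $L$ over $\{a_1,\dots,a_k\}$ is bounded if $L\subseteq a_1^*a_2^*\cdots a_k^*$. A CA is $\langle S,F,A,B,\#,b_l,b_r,\delta\rangle$ with communication functions $b_l,b_r:S\to B\cup\{\bot\}$ ($\bot$: nothing sent) and local transition $\delta:(B\cup\{\#,\bot\})\times S\times(B\cup\{\#,\bot\})\to S$; cells $1..|w|$ start with input letters and update synchronously by $c_{t+1}(i)=\delta(b_r(c_t(i-1)),c_t(i),b_l(c_t(i+1)))$, outer cells receiving $\#$ once at the first step. Acceptance: the leftmost cell enters an accepting state; real time: accepted inputs accepted within $|w|$ steps. OCA: $b_r\equiv\bot$, leftmost cell gets no boundary symbol. $\mathrm{com}(i,t)$: number of steps $j<t$ with $b_r(c_j(i))\ne\bot$ or $b_l(c_j(i+1))\ne\bot$; $\mathrm{mcom}(w)=\max_i\mathrm{com}(i,t(|w|))$, $\mathrm{scom}(w)=\sum_{i=1}^{|w|-1}\mathrm{com}(i,t(|w|))$. Max (sum) communication bounded by $f$: every accepted $w$ is accepted with $\mathrm{mcom}(w)\le f(|w|)$ ($\mathrm{scom}(w)\le f(|w|)$). $\mathrm{SC\text{-}OCA}(n)$ /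 $\mathrm{MC\text{-}OCA}(\log n)$: OCAs sum communication bounded by some $g\in O(n)$ / max communication bounded by some $g\in O(\log n)$. *)

theory Defs
  imports "HOL-Library.Landau_Symbols" "HOL-Library.Nat_Bijection"
begin

datatype recf = Zero | Succ | Proj nat | Comp recf "recf list" | Prec recf recf | Mn recf

inductive eval :: "recf \<Rightarrow> nat list \<Rightarrow> nat \<Rightarrow> bool" where
  eval_Zero: "eval Zero xs 0"
| eval_Succ: "eval Succ (x # xs) (Suc x)"
| eval_Proj: "i < length xs \<Longrightarrow> eval (Proj i) xs (xs ! i)"
| eval_Comp: "\<lbrakk>length ys = length gs; \<forall>i < length gs. eval (gs ! i) xs (ys ! i); eval f ys r\<rbrakk>
               \<Longrightarrow> eval (Comp f gs) xs r"
| eval_Prec0: "eval f xs r \<Longrightarrow> eval (Prec f g) (0 # xs) r"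
| eval_PrecS: "\<lbrakk>eval (Prec f g) (n # xs) r; eval g (r # n # xs) r'\<rbrakk>
               \<Longrightarrow> eval (Prec f g) (Suc n # xs) r'"
| eval_Mn: "\<lbrakk>eval f (r # xs) 0; \<forall>i < r. \<exists>v. eval f (i # xs) v \<and> 0 < v\<rbrakk>
               \<Longrightarrow> eval (Mn f) xs r"

text \<open>Symbols a cell can receive from its right neighbour: a message from B,
  the boundary symbol #, or nothing (bottom).\<close>
datatype sym = Msg nat | Hash | Bot

text \<open>Concrete finite description of an OCA.
  States: {0..<nst}.  Accepting states F: fin.  Input alphabet A (subset of the
  states): inp.  Communication alphabet B: {0..<ncom}.
  Left communication function b_l: bl ! s = 0 means bottom (nothing sent),
  bl ! s = Suc b means message b is sent.  (b_r is identically bottom.)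
  Local transition delta(bottom, s, x): dl ! s ! 0 for x = bottom,
  dl ! s ! 1 for x = #, dl ! s ! (b+2) for x = message b.\<close>
datatype oca = OCA (nst: nat) (fin: "nat list") (inp: "nat list") (ncom: nat)
                   (bl: "nat list") (dl: "nat list list")

definition wf_oca :: "oca \<Rightarrow> bool" where
  "wf_oca M \<longleftrightarrow>
     set (fin M) \<subseteq> {0..<nst M} \<and> set (inp M) \<subseteq> {0..<nst M} \<and>
     length (bl M) = nst M \<and> (\<forall>s < nst M. bl M ! s \<le> ncom M) \<and>
     length (dl M) = nst M \<and>
     (\<forall>s < nst M. length (dl M ! s) = ncom M + 2 \<and> (\<forall>x \<in> set (dl M ! s). x < nst M))"

definition blf :: "oca \<Rightarrow> nat \<Rightarrow> sym" where
  "blf M s = (case bl M ! s of 0 \<Rightarrow> Bot | Suc b \<Rightarrow> Msg b)"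

definition sym_idx :: "sym \<Rightarrow> nat" where
  "sym_idx x = (case x of Bot \<Rightarrow> 0 | Hash \<Rightarrow> 1 | Msg b \<Rightarrow> b + 2)"

definition dlt :: "oca \<Rightarrow> nat \<Rightarrow> sym \<Rightarrow> nat" where
  "dlt M s x = dl M ! s ! sym_idx x"

text \<open>cfg M w t i: state of cell i (1 \<le> i \<le> |w|) at time t on input w.
  The rightmost cell receives # at the first step only; the leftmost cell
  receives nothing from the left (one-way).\<close>
primrec cfg :: "oca \<Rightarrow> nat list \<Rightarrow> nat \<Rightarrow> nat \<Rightarrow> nat" where
  "cfg M w 0 = (\<lambda>i. w ! (i - 1))"
| "cfg M w (Suc t) = (\<lambda>i. dlt M (cfg M w t i)
      (if i < length w then blf M (cfg M w t (Suc i)) else if t = 0 then Hash else Bot))"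

definition accepts :: "oca \<Rightarrow> nat list \<Rightarrow> bool" where
  "accepts M w \<longleftrightarrow> w \<noteq> [] \<and> set w \<subseteq> set (inp M) \<and>
     (\<exists>t \<ge> 1. cfg M w t 1 \<in> set (fin M))"

definition lang :: "oca \<Rightarrow> nat list set" where
  "lang M = {w. accepts M w}"

definition real_time :: "oca \<Rightarrow> bool" where
  "real_time M \<longleftrightarrow> (\<forall>w \<in> lang M. \<exists>t. 1 \<le> t \<and> t \<le> length w \<and> cfg M w t 1 \<in> set (fin M))"

text \<open>com(i,t) for an OCA (b_r is identically bottom).\<close>
definition com :: "oca \<Rightarrow> nat list \<Rightarrow> nat \<Rightarrow> nat \<Rightarrow> nat" where
  "com M w i t = card {j. j < t \<and> blf M (cfg M w j (Suc i)) \<noteq> Bot}"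

text \<open>Real time: t(|w|) = |w|.\<close>
definition mcom :: "oca \<Rightarrow> nat list \<Rightarrow> nat" where
  "mcom M w = Max (insert 0 {com M w i (length w) | i. 1 \<le> i \<and> i \<le> length w - 1})"

definition scom :: "oca \<Rightarrow> nat list \<Rightarrow> nat" where
  "scom M w = (\<Sum>i = 1..length w - 1. com M w i (length w))"

definition sum_com_linear :: "oca \<Rightarrow> bool" where
  "sum_com_linear M \<longleftrightarrow> (\<exists>g :: nat \<Rightarrow> nat. (\<lambda>n. real (g n)) \<in> O(\<lambda>n. real n) \<and>
       (\<forall>w \<in> lang M. scom M w \<le> g (length w)))"

definition max_com_log :: "oca \<Rightarrow> bool" where
  "max_com_log M \<longleftrightarrow> (\<exists>g :: nat \<Rightarrow> nat. (\<lambda>n. real (g n)) \<in> O(\<lambda>n. ln (real n)) \<and>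
       (\<forall>w \<in> lang M. mcom M w \<le> g (length w)))"

definition bounded_lang :: "nat list \<Rightarrow> nat list set \<Rightarrow> bool" where
  "bounded_lang A L \<longleftrightarrow> (\<exists>as. distinct as \<and> set as = set A \<and>
     L \<subseteq> {concat (map (\<lambda>(a, k). replicate k a) (zip as ks)) | ks. length ks = length as})"

definition oca_code :: "oca \<Rightarrow> nat" where
  "oca_code M = list_encode [nst M, list_encode (fin M), list_encode (inp M), ncom M,
                             list_encode (bl M), list_encode (map list_encode (dl M))]"

definition emptiness_decidable :: "(oca \<Rightarrow> bool) \<Rightarrow> bool" where
  "emptiness_decidable C \<longleftrightarrow> (\<exists>f. \<forall>M. wf_oca M \<and> C M \<longrightarrow>
      eval f [oca_code M] (if lang M = {} then 1 else 0))"

end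

theory Submission
  imports Defs
begin

text \<open>
  One family of automata serves both classes: every cell sends at most a constant number of messages.
  On an input \<open>a\<^sup>p c\<^sup>q\<close>, the cell at the border of the two blocks emits the initial configuration of a
  counter machine towards the left, and every further cell of the \<open>a\<close>-block performs one machine step.
  A counter is coded in time: its marker passes a cell as many steps after the program counter
  as the counter says. Incrementing a counter means delaying its marker by one step, decrementing it
  means delaying everything else, and a zero test asks whether the marker arrives together with the
  program counter. The boundary symbol triggers a signal of full speed, and the input is accepted if
  this signal meets a halted computation in the leftmost cell; so accepted inputs are accepted
  at time \<open>p + q\<close>, and the language is nonempty if and only if the machine halts.

  The machine input \<open>x\<close> is hardwired by a chain of \<open>x + 1\<close> silent states, so that the flatten of the automaton is a
  recursive function \<open>hardwire u x\<close> of the machine part \<open>u\<close> and of \<open>x\<close>. If \<open>f\<close> decides emptiness,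
  the machine that computes \<open>f (hardwire x x)\<close> and halts if and only if the result is nonzero, applied to
  its own part \<open>u\<close>, halts if and only if it does not halt.
\<close>


section \<open>Closure properties of recursive functions\<close>

text \<open>Total functions of fixed arity, up to their values on lists of length \<open>n\<close>.
  Stated for functions instead of \<open>recf\<close> terms, so that recursiveness follows the shape
  of an expression.\<close>

definition recfun :: "nat \<Rightarrow> (nat list \<Rightarrow> nat) \<Rightarrow> bool" where
  "recfun n F \<longleftrightarrow> (\<exists>r. \<forall>xs. length xs = n \<longrightarrow> eval r xs (F xs))"

lemma recfun_cong:
  assumes "recfun n F" "\<And>xs. length xs = n \<Longrightarrow> F xs = G xs"
  shows "recfun n G"
  using assms unfolding recfun_def by metis

lemma recfun_proj: "i < n \<Longrightarrow> recfun n (\<lambda>xs. xs ! i)"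
  unfolding recfun_def by (rule exI[of _ "Proj i"]) (simp add: eval_Proj)

lemma recfun_zero: "recfun n (\<lambda>xs. 0)"
  unfolding recfun_def by (rule exI[of _ Zero]) (simp add: eval_Zero)

lemma recfun_comp:
  assumes "recfun (length As) G" "\<And>A. A \<in> set As \<Longrightarrow> recfun n A"
  shows "recfun n (\<lambda>xs. G (map (\<lambda>A. A xs) As))"
proof -
  obtain g where g: "\<And>xs. length xs = length As \<Longrightarrow> eval g xs (G xs)"
    using assms(1) unfolding recfun_def by blast
  obtain h where h: "\<And>A xs. A \<in> set As \<Longrightarrow> length xs = n \<Longrightarrow> eval (h A) xs (A xs)"
    using assms(2) unfolding recfun_def by metis
  have "eval (Comp g (map h As)) xs (G (map (\<lambda>A. A xs) As))" if "length xs = n" for xs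
    by (rule eval_Comp[where ys = "map (\<lambda>A. A xs) As"]) (auto simp: h that intro: g)
  then show ?thesis unfolding recfun_def by blast
qed

lemma recfun_Suc: "recfun n A \<Longrightarrow> recfun n (\<lambda>xs. Suc (A xs))"
proof -
  assume A: "recfun n A"
  have "recfun (length [A]) (\<lambda>xs. Suc (hd xs))"
    unfolding recfun_def
    by (rule exI[of _ Succ]) (auto simp: length_Suc_conv intro: eval_Succ)
  from recfun_comp[OF this, of n] A show ?thesis by simp
qed

lemma recfun_const: "recfun n (\<lambda>xs. k)"
  by (induction k) (auto intro: recfun_zero recfun_Suc)

lemma recfun_prec:
  assumes "recfun n F" "recfun (Suc (Suc n)) G" "recfun n K"
  shows "recfun n (\<lambda>xs. rec_nat (F xs) (\<lambda>i r. G (r # i # xs)) (K xs))"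
proof -
  let ?H = "\<lambda>ys. rec_nat (F (tl ys)) (\<lambda>i r. G (r # i # tl ys)) (hd ys)"
  \<comment> \<open>\<open>Prec\<close> recurses on the head of its argument list, so the bound
    \<open>K\<close> is put in front of all projections.\<close>
  let ?As = "K # map (\<lambda>i xs. xs ! i) [0..<n]"
  obtain f where f: "\<And>xs. length xs = n \<Longrightarrow> eval f xs (F xs)"
    using assms(1) unfolding recfun_def by blast
  obtain g where g: "\<And>xs. length xs = Suc (Suc n) \<Longrightarrow> eval g xs (G xs)"
    using assms(2) unfolding recfun_def by blast
  have "eval (Prec f g) (k # xs) (?H (k # xs))" if "length xs = n" for k xs
    by (induction k) (auto intro!: eval_Prec0 eval_PrecS f g simp: that)
  then have "recfun (length ?As) ?H"
    unfolding recfun_def by (auto simp: length_Suc_conv intro!: exI[of _ "Prec f g"])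
  moreover have "recfun n A" if "A \<in> set ?As" for A
    using that assms(3) recfun_proj by auto
  ultimately have "recfun n (\<lambda>xs. ?H (map (\<lambda>A. A xs) ?As))"
    by (rule recfun_comp[where As = ?As and G = ?H])
  moreover have "map (\<lambda>A. A xs) ?As = K xs # xs" if "length xs = n" for xs
    using that by (simp add: comp_def) (metis map_nth)
  ultimately show ?thesis
    by (elim recfun_cong) simp
qed

lemma recfun_least:
  assumes "recfun (Suc n) G" "\<And>xs. length xs = n \<Longrightarrow> \<exists>r. G (r # xs) = 0"
  shows "recfun n (\<lambda>xs. LEAST r. G (r # xs) = 0)"
proof -
  obtain g where g: "\<And>xs. length xs = Suc n \<Longrightarrow> eval g xs (G xs)"
    using assms(1) unfolding recfun_def by blast
  have "eval (Mn g) xs (LEAST r. G (r # xs) = 0)" if xs: "length xs = n" for xs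
  proof (rule eval_Mn)
    show "eval g ((LEAST r. G (r # xs) = 0) # xs) 0"
      using g[of "(LEAST r. G (r # xs) = 0) # xs"] LeastI_ex[OF assms(2)[OF xs]] xs by simp
    show "\<forall>i<LEAST r. G (r # xs) = 0. \<exists>v. eval g (i # xs) v \<and> 0 < v"
    proof (intro allI impI)
      fix i assume "i < (LEAST r. G (r # xs) = 0)"
      then have "0 < G (i # xs)" using not_less_Least by blast
      then show "\<exists>v. eval g (i # xs) v \<and> 0 < v" using g[of "i # xs"] xs by auto
    qed
  qed
  then show ?thesis unfolding recfun_def by blast
qed

lemma recfun_add:
  assumes "recfun n A" "recfun n B" shows "recfun n (\<lambda>xs. A xs + B xs)"
proof -
  have *: "rec_nat b (\<lambda>i r. Suc ((r # i # xs) ! 0)) a = a + b" for a b :: nat and xs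
    by (induction a) auto
  show ?thesis
    using recfun_prec[OF assms(2) recfun_Suc[OF recfun_proj[of 0]] assms(1)] unfolding * by simp
qed

lemma recfun_pred: assumes "recfun n A" shows "recfun n (\<lambda>xs. A xs - 1)"
proof -
  have *: "rec_nat 0 (\<lambda>i r. (r # i # xs) ! 1) a = a - 1" for a :: nat and xs
    by (cases a) auto
  show ?thesis
    using recfun_prec[OF recfun_zero recfun_proj[of 1] assms] unfolding * by simp
qed

lemma recfun_diff:
  assumes "recfun n A" "recfun n B" shows "recfun n (\<lambda>xs. A xs - B xs)"
proof -
  have *: "rec_nat a (\<lambda>i r. (r # i # xs) ! 0 - 1) b = a - b" for a b :: nat and xs
    by (induction b) auto
  show ?thesis
    using recfun_prec[OF assms(1) recfun_pred[OF recfun_proj[of 0]] assms(2)] unfolding * by simp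
qed

section \<open>Pairs and lists as numbers\<close>

lemma recfun_triangle: assumes "recfun n A" shows "recfun n (\<lambda>xs. triangle (A xs))"
proof -
  have *: "rec_nat 0 (\<lambda>i r. (r # i # xs) ! 0 + Suc ((r # i # xs) ! 1)) a = triangle a" for a xs
    by (induction a) auto
  show ?thesis
    using recfun_prec[OF recfun_zero recfun_add[OF recfun_proj[of 0] recfun_Suc[OF recfun_proj[of 1]]] assms]
    unfolding * by simp
qed

lemma recfun_prod_encode:
  assumes "recfun n A" "recfun n B" shows "recfun n (\<lambda>xs. prod_encode (A xs, B xs))"
  unfolding prod_encode_def using assms by (auto intro!: recfun_add recfun_triangle)

definition ncons :: "nat \<Rightarrow> nat \<Rightarrow> nat" where
  "ncons a v = Suc (prod_encode (a, v))"

definition nhd :: "nat \<Rightarrow> nat" where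
  "nhd z = fst (prod_decode (z - 1))"

definition ntl :: "nat \<Rightarrow> nat" where
  "ntl z = snd (prod_decode (z - 1))"

lemma list_encode_Cons: "list_encode (x # xs) = ncons x (list_encode xs)"
  by (simp add: ncons_def)

lemma nhd_ncons [simp]: "nhd (ncons a v) = a"
  and ntl_ncons [simp]: "ntl (ncons a v) = v"
  by (simp_all add: ncons_def nhd_def ntl_def)

lemma recfun_ncons:
  "recfun n A \<Longrightarrow> recfun n B \<Longrightarrow> recfun n (\<lambda>xs. ncons (A xs) (B xs))"
  unfolding ncons_def by (auto intro!: recfun_Suc recfun_prod_encode)

lemma triangle_mono: "m \<le> n \<Longrightarrow> triangle m \<le> triangle n"
  by (induction rule: dec_induct) auto

text \<open>Cantor pairing places \<open>(a, b)\<close> at \<open>triangle (a + b) + a\<close>,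
  below the next triangular number. Truncated subtraction turns this comparison into an equation
  with 0, fit for minimization.\<close>

lemma triangle_root:
  "(LEAST s. Suc (triangle (a + b) + a) - triangle (Suc s) = 0) = a + b"
proof (rule Least_equality)
  fix s assume "Suc (triangle (a + b) + a) - triangle (Suc s) = 0"
  then have "triangle (a + b) < triangle (Suc s)" by simp
  then show "a + b \<le> s"
    using triangle_mono[of "Suc s" "a + b"] by linarith
qed simp

lemma recfun_prod_decode:
  assumes "recfun n A"
  shows "recfun n (\<lambda>xs. fst (prod_decode (A xs)))" "recfun n (\<lambda>xs. snd (prod_decode (A xs)))"
proof -
  let ?G = "\<lambda>ys. Suc ((ys :: nat list) ! 1) - triangle (Suc (ys ! 0))"
  let ?s = "\<lambda>y. LEAST s. Suc y - triangle (Suc s) = 0"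
  have root: "?s y = fst (prod_decode y) + snd (prod_decode y)"
    and dec: "y = triangle (fst (prod_decode y) + snd (prod_decode y)) + fst (prod_decode y)" for y
  proof -
    obtain a b where y: "y = prod_encode (a, b)" by (metis prod_decode_inverse surj_pair)
    show "?s y = fst (prod_decode y) + snd (prod_decode y)"
      using triangle_root[of a b] unfolding y prod_encode_inverse
      by (simp add: prod_encode_def)
    show "y = triangle (fst (prod_decode y) + snd (prod_decode y)) + fst (prod_decode y)"
      unfolding y prod_encode_inverse by (simp add: prod_encode_def)
  qed
  have "recfun 2 ?G"
    by (intro recfun_diff recfun_Suc recfun_triangle recfun_proj) auto
  \<comment> \<open>The search always succeeds: the code itself is large enough as
    \<open>r\<close>.\<close>
  moreover have "\<exists>r. ?G (r # xs) = 0" for xs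
  proof
    have "Suc m \<le> triangle (Suc m)" for m by (induction m) auto
    then show "?G (xs ! 0 # xs) = 0" by simp
  qed
  ultimately have "recfun 1 (\<lambda>xs. LEAST r. ?G (r # xs) = 0)"
    using recfun_least[of 1 ?G] by (simp add: numeral_2_eq_2)
  then have s: "recfun n (\<lambda>xs. ?s (A xs))"
    using recfun_comp[of "[A]" "\<lambda>xs. LEAST r. ?G (r # xs) = 0" n] assms by simp
  have 1: "y - triangle (?s y) = fst (prod_decode y)" for y
    using root[of y] dec[of y] by (metis add_diff_cancel_left')
  have 2: "?s y - (y - triangle (?s y)) = snd (prod_decode y)" for y
    unfolding 1 unfolding root by simp
  show "recfun n (\<lambda>xs. fst (prod_decode (A xs)))"
    using recfun_diff[OF assms recfun_triangle[OF s]] unfolding 1 .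
  show "recfun n (\<lambda>xs. snd (prod_decode (A xs)))"
    using recfun_diff[OF s recfun_diff[OF assms recfun_triangle[OF s]]] unfolding 2 .
qed

lemma recfun_nhd: "recfun n A \<Longrightarrow> recfun n (\<lambda>xs. nhd (A xs))"
  and recfun_ntl: "recfun n A \<Longrightarrow> recfun n (\<lambda>xs. ntl (A xs))"
  unfolding nhd_def ntl_def by (auto intro!: recfun_prod_decode recfun_pred simp del: One_nat_def)

section \<open>Compiling recursive functions to counter machines\<close>

datatype cmd = INC nat | DEC nat | SEQ cmd cmd | LOOP nat cmd

text \<open>Only terminating executions are derivable. The loop head tests and decrements
  \<open>k\<close> at once, like the instruction it is flattened to; the body may change
  \<open>k\<close> too, so these are while loops.\<close>

inductive exec :: "cmd \<Rightarrow> (nat \<Rightarrow> nat) \<Rightarrow> (nat \<Rightarrow> nat) \<Rightarrow> bool" where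
  exec_INC: "exec (INC k) \<sigma> (\<sigma>(k := Suc (\<sigma> k)))"
| exec_DEC: "exec (DEC k) \<sigma> (\<sigma>(k := \<sigma> k - 1))"
| exec_SEQ: "exec c \<sigma> \<sigma>1 \<Longrightarrow> exec d \<sigma>1 \<sigma>2 \<Longrightarrow> exec (SEQ c d) \<sigma> \<sigma>2"
| exec_LOOP_0: "\<sigma> k = 0 \<Longrightarrow> exec (LOOP k c) \<sigma> \<sigma>"
| exec_LOOP_Suc: "\<sigma> k = Suc m \<Longrightarrow> exec c (\<sigma>(k := m)) \<sigma>1 \<Longrightarrow> exec (LOOP k c) \<sigma>1 \<sigma>2
    \<Longrightarrow> exec (LOOP k c) \<sigma> \<sigma>2"

text \<open>Both \<open>DEC\<close> and the loop head decrement; the truncated decrement makes this harmless.\<close>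
definition CLR :: "nat \<Rightarrow> cmd" where
  "CLR k = LOOP k (DEC k)"

lemma exec_CLR: "exec (CLR k) \<sigma> (\<sigma>(k := 0))"
proof (induction "\<sigma> k" arbitrary: \<sigma> rule: less_induct)
  case less
  show ?case
  proof (cases "\<sigma> k")
    case 0
    then have "\<sigma>(k := 0) = \<sigma>" by auto
    with 0 show ?thesis unfolding CLR_def by (simp add: exec_LOOP_0)
  next
    case (Suc m)
    have "exec (DEC k) (\<sigma>(k := m)) (\<sigma>(k := m - 1))"
      using exec_DEC[of k "\<sigma>(k := m)"] by simp
    moreover have "exec (CLR k) (\<sigma>(k := m - 1)) (\<sigma>(k := 0))"
      using less[of "\<sigma>(k := m - 1)"] Suc by simp
    ultimately show ?thesis
      using Suc unfolding CLR_def by (blast intro: exec_LOOP_Suc)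
  qed
qed

text \<open>Rule for counted loops: the body hands \<open>k\<close> back as the head left it, so
  there are exactly \<open>n\<close> rounds, and \<open>I i\<close> holds after \<open>i\<close> of
  them.\<close>

lemma exec_LOOP_iterate:
  assumes "I 0 \<sigma>" "\<sigma> k = n"
    and step: "\<And>i \<sigma>. i < n \<Longrightarrow> I i \<sigma> \<Longrightarrow> \<sigma> k = n - i \<Longrightarrow>
      \<exists>\<sigma>'. exec c (\<sigma>(k := n - Suc i)) \<sigma>' \<and> I (Suc i) \<sigma>' \<and> \<sigma>' k = n - Suc i"
  shows "\<exists>\<sigma>'. exec (LOOP k c) \<sigma> \<sigma>' \<and> I n \<sigma>'"
proof -
  have "\<exists>\<sigma>'. exec (LOOP k c) \<sigma> \<sigma>' \<and> I n \<sigma>'" if "j \<le> n" "I (n - j) \<sigma>" "\<sigma> k = j" for j \<sigma>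
    using that
  proof (induction j arbitrary: \<sigma>)
    case 0
    then show ?case using exec_LOOP_0 by auto
  next
    case (Suc j)
    have "n - (n - Suc j) = Suc j" "n - Suc (n - Suc j) = j" "Suc (n - Suc j) = n - j"
      "n - Suc j < n" using Suc.prems by auto
    with step[of "n - Suc j" \<sigma>] Suc.prems obtain \<sigma>1
      where "exec c (\<sigma>(k := j)) \<sigma>1" "I (n - j) \<sigma>1" "\<sigma>1 k = j" by auto
    moreover with Suc.IH[of \<sigma>1] Suc.prems obtain \<sigma>2 where "exec (LOOP k c) \<sigma>1 \<sigma>2" "I n \<sigma>2" by auto
    ultimately show ?case using exec_LOOP_Suc Suc.prems by blast
  qed
  from this[of n] assms show ?thesis by auto
qed

text \<open>Moving a counter destroys it; hence the detour through \<open>t\<close>, which refills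
  both source and target.\<close>

definition CPY :: "nat \<Rightarrow> nat \<Rightarrow> nat \<Rightarrow> cmd" where
  "CPY i out t = SEQ (CLR out) (SEQ (CLR t) (SEQ (LOOP i (INC t)) (LOOP t (SEQ (INC i) (INC out)))))"

lemma exec_CPY:
  assumes "i \<noteq> out" "t \<noteq> i" "t \<noteq> out"
  shows "exec (CPY i out t) \<sigma> (\<sigma>(t := 0, out := \<sigma> i))"
proof -
  define \<sigma>1 where "\<sigma>1 = \<sigma>(out := 0, t := 0)"
  define \<sigma>2 where "\<sigma>2 = \<sigma>(out := 0, t := \<sigma> i, i := 0)"
  have "\<exists>\<sigma>'. exec (LOOP i (INC t)) \<sigma>1 \<sigma>' \<and> \<sigma>' = \<sigma>1(t := \<sigma> i, i := \<sigma> i - \<sigma> i)"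
  proof (rule exec_LOOP_iterate[where I = "\<lambda>j s. s = \<sigma>1(t := j, i := \<sigma> i - j)"])
    show "\<sigma>1 = \<sigma>1(t := 0, i := \<sigma> i - 0)" "\<sigma>1 i = \<sigma> i" using assms by (auto simp: \<sigma>1_def)
  next
    fix j \<sigma>' assume *: "\<sigma>' = \<sigma>1(t := j, i := \<sigma> i - j)" "j < \<sigma> i"
    have "(\<sigma>'(i := \<sigma> i - Suc j))(t := Suc ((\<sigma>'(i := \<sigma> i - Suc j)) t))
        = \<sigma>1(t := Suc j, i := \<sigma> i - Suc j)"
      using assms * by (auto simp: fun_eq_iff)
    then show "\<exists>\<sigma>''. exec (INC t) (\<sigma>'(i := \<sigma> i - Suc j)) \<sigma>'' \<and> \<sigma>'' = \<sigma>1(t := Suc j, i := \<sigma> i - Suc j)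
        \<and> \<sigma>'' i = \<sigma> i - Suc j"
      using exec_INC[of t "\<sigma>'(i := \<sigma> i - Suc j)"] by auto
  qed
  moreover have "\<sigma>1(t := \<sigma> i, i := \<sigma> i - \<sigma> i) = \<sigma>2"
    using assms by (auto simp: \<sigma>1_def \<sigma>2_def fun_eq_iff)
  ultimately have 1: "exec (LOOP i (INC t)) \<sigma>1 \<sigma>2" by simp
  have "\<exists>\<sigma>'. exec (LOOP t (SEQ (INC i) (INC out))) \<sigma>2 \<sigma>'
      \<and> \<sigma>' = \<sigma>2(t := \<sigma> i - \<sigma> i, i := \<sigma> i, out := \<sigma> i)"
  proof (rule exec_LOOP_iterate[where I = "\<lambda>j s. s = \<sigma>2(t := \<sigma> i - j, i := j, out := j)"])
    show "\<sigma>2 = \<sigma>2(t := \<sigma> i - 0, i := 0, out := 0)" "\<sigma>2 t = \<sigma> i" using assms by (auto simp: \<sigma>2_def)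
  next
    fix j \<sigma>' assume *: "\<sigma>' = \<sigma>2(t := \<sigma> i - j, i := j, out := j)" "j < \<sigma> i"
    let ?s = "\<sigma>'(t := \<sigma> i - Suc j)" and ?s' = "\<sigma>2(t := \<sigma> i - Suc j, i := Suc j, out := Suc j)"
    have "exec (INC i) ?s (?s(i := Suc (?s i)))"
         "exec (INC out) (?s(i := Suc (?s i))) ((?s(i := Suc (?s i)))(out := Suc ((?s(i := Suc (?s i))) out)))"
      by (rule exec_INC)+
    moreover have "(?s(i := Suc (?s i)))(out := Suc ((?s(i := Suc (?s i))) out)) = ?s'"
      using assms * by (auto simp: fun_eq_iff)
    ultimately have "exec (SEQ (INC i) (INC out)) ?s ?s'" by (metis exec_SEQ)
    then show "\<exists>\<sigma>''. exec (SEQ (INC i) (INC out)) ?s \<sigma>'' \<and> \<sigma>'' = ?s' \<and> \<sigma>'' t = \<sigma> i - Suc j"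
      using assms by auto
  qed
  moreover have "\<sigma>2(t := \<sigma> i - \<sigma> i, i := \<sigma> i, out := \<sigma> i) = \<sigma>(t := 0, out := \<sigma> i)"
    using assms by (auto simp: \<sigma>2_def fun_eq_iff)
  ultimately have "exec (LOOP t (SEQ (INC i) (INC out))) \<sigma>2 (\<sigma>(t := 0, out := \<sigma> i))" by simp
  with 1 show ?thesis
    unfolding CPY_def \<sigma>1_def by (blast intro: exec_SEQ exec_CLR)
qed

text \<open>\<open>compile r as out b\<close> reads its arguments from the registers \<open>as\<close>, writes its result to
  \<open>out\<close> and uses the registers from \<open>b\<close> on as scratch space, whatever they contain.\<close>
function (sequential) compile :: "recf \<Rightarrow> nat list \<Rightarrow> nat \<Rightarrow> nat \<Rightarrow> cmd"
  and compile_list :: "recf list \<Rightarrow> nat list \<Rightarrow> nat \<Rightarrow> nat \<Rightarrow> cmd" where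
  "compile Zero as out b = CLR out"
| "compile Succ as out b = SEQ (CPY (as ! 0) out b) (INC out)"
| "compile (Proj i) as out b = CPY (as ! i) out b"
| "compile (Comp f gs) as out b =
     SEQ (compile_list gs as b (b + length gs)) (compile f [b..<b + length gs] out (b + length gs))"
| "compile (Prec f g) as out b =
     SEQ (CPY (as ! 0) b (b + 4)) (SEQ (CLR (b + 2)) (SEQ (compile f (tl as) (b + 1) (b + 4))
       (SEQ (LOOP b (SEQ (compile g ((b + 1) # (b + 2) # tl as) (b + 3) (b + 4))
                      (SEQ (CPY (b + 3) (b + 1) (b + 4)) (INC (b + 2)))))
         (CPY (b + 1) out (b + 4)))))"
| "compile (Mn f) as out b =
     SEQ (CLR b) (SEQ (compile f (b # as) (b + 1) (b + 2))
       (SEQ (LOOP (b + 1) (SEQ (INC b) (compile f (b # as) (b + 1) (b + 2)))) (CPY b out (b + 2))))"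
| "compile_list [] as k b = CLR b"
| "compile_list (g # gs) as k b = SEQ (compile g as k b) (compile_list gs as (Suc k) b)"
  by pat_completeness auto
termination
  by (relation "measure (\<lambda>x. case x of Inl (r, _) \<Rightarrow> size r | Inr (rs, _) \<Rightarrow> size_list size rs)") auto

text \<open>Only the argument registers have prescribed contents, and below \<open>b\<close> only
  \<open>out\<close> changes, so calls can be nested and repeated in loops.\<close>

definition realizes :: "recf \<Rightarrow> bool" where
  "realizes r \<longleftrightarrow> (\<forall>as out b xs v \<sigma>. eval r xs v \<longrightarrow> length as = length xs \<longrightarrow> out < b \<longrightarrow>
     (\<forall>i < length xs. as ! i < b \<and> as ! i \<noteq> out \<and> \<sigma> (as ! i) = xs ! i) \<longrightarrow>
     (\<exists>\<sigma>'. exec (compile r as out b) \<sigma> \<sigma>' \<and> \<sigma>' out = v \<and> (\<forall>j < b. j \<noteq> out \<longrightarrow> \<sigma>' j = \<sigma> j)))"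

lemma realizesD:
  assumes "realizes r" "eval r xs v" "length as = length xs" "out < b"
    "\<And>i. i < length xs \<Longrightarrow> as ! i < b \<and> as ! i \<noteq> out \<and> \<sigma> (as ! i) = xs ! i"
  shows "\<exists>\<sigma>'. exec (compile r as out b) \<sigma> \<sigma>' \<and> \<sigma>' out = v \<and> (\<forall>j < b. j \<noteq> out \<longrightarrow> \<sigma>' j = \<sigma> j)"
  using assms unfolding realizes_def by blast

text \<open>All calls share the scratch space from \<open>b\<close> on, which lies above the result
  registers. The \<open>CLR b\<close> of the empty list acts as a skip.\<close>

lemma compile_list_realizes:
  assumes "\<And>g. g \<in> set gs \<Longrightarrow> realizes g" "length ys = length gs"
    "\<forall>i < length gs. eval (gs ! i) xs (ys ! i)" "length as = length xs" "k + length gs \<le> b"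
    "\<And>i. i < length xs \<Longrightarrow> as ! i < k \<and> \<sigma> (as ! i) = xs ! i"
  shows "\<exists>\<sigma>'. exec (compile_list gs as k b) \<sigma> \<sigma>' \<and> (\<forall>i < length gs. \<sigma>' (k + i) = ys ! i)
    \<and> (\<forall>j < k. \<sigma>' j = \<sigma> j)"
  using assms
proof (induction gs arbitrary: ys k \<sigma>)
  case Nil
  then show ?case using exec_CLR[of b \<sigma>] by (auto intro!: exI[of _ "\<sigma>(b := 0)"])
next
  case (Cons g gs)
  obtain y ys' where ys: "ys = y # ys'" using Cons.prems(2) by (cases ys) auto
  have "eval g xs y" using Cons.prems(3) ys by auto
  then have "\<exists>\<sigma>'. exec (compile g as k b) \<sigma> \<sigma>' \<and> \<sigma>' k = y \<and> (\<forall>j < b. j \<noteq> k \<longrightarrow> \<sigma>' j = \<sigma> j)"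
  proof (rule realizesD[rotated])
    show "as ! i < b \<and> as ! i \<noteq> k \<and> \<sigma> (as ! i) = xs ! i" if "i < length xs" for i
      using Cons.prems(5) Cons.prems(6)[OF that] by auto
  qed (use Cons.prems in auto)
  then obtain \<sigma>1 where 1: "exec (compile g as k b) \<sigma> \<sigma>1" "\<sigma>1 k = y"
    "\<And>j. j < b \<Longrightarrow> j \<noteq> k \<Longrightarrow> \<sigma>1 j = \<sigma> j" by blast
  have "\<exists>\<sigma>'. exec (compile_list gs as (Suc k) b) \<sigma>1 \<sigma>' \<and> (\<forall>i < length gs. \<sigma>' (Suc k + i) = ys' ! i)
    \<and> (\<forall>j < Suc k. \<sigma>' j = \<sigma>1 j)"
  proof (rule Cons.IH)
    show "\<forall>i<length gs. eval (gs ! i) xs (ys' ! i)"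
      using Cons.prems(3) ys by (metis Suc_less_eq length_Cons nth_Cons_Suc)
    show "as ! i < Suc k \<and> \<sigma>1 (as ! i) = xs ! i" if "i < length xs" for i
      using Cons.prems(5) Cons.prems(6)[OF that] 1(3)[of "as ! i"] by auto
  qed (use Cons.prems ys in auto)
  then obtain \<sigma>2 where 2: "exec (compile_list gs as (Suc k) b) \<sigma>1 \<sigma>2"
    "\<And>i. i < length gs \<Longrightarrow> \<sigma>2 (Suc k + i) = ys' ! i" "\<And>j. j < Suc k \<Longrightarrow> \<sigma>2 j = \<sigma>1 j"
    by blast
  have "\<sigma>2 (k + i) = ys ! i" if "i < length (g # gs)" for i
    using that 2(2)[of "i - 1"] 2(3)[of k] 1(2) ys by (cases i) auto
  moreover have "\<sigma>2 j = \<sigma> j" if "j < k" for j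
    using that 2(3)[of j] 1(3)[of j] Cons.prems(5) by auto
  moreover have "exec (compile_list (g # gs) as k b) \<sigma> \<sigma>2"
    using 1(1) 2(1) by (auto intro: exec_SEQ)
  ultimately show ?case by blast
qed

lemma eval_Prec_trace:
  assumes "eval (Prec f g) (n # xs) v"
  shows "\<exists>h. eval f xs (h 0) \<and> (\<forall>i < n. eval g (h i # i # xs) (h (Suc i))) \<and> h n = v"
  using assms
proof (induction n arbitrary: v)
  case 0
  then show ?case by (cases rule: eval.cases) (auto intro: exI[of _ "\<lambda>_. v"])
next
  case (Suc n)
  from Suc.prems obtain r where r: "eval (Prec f g) (n # xs) r" "eval g (r # n # xs) v"
    by (cases rule: eval.cases) auto
  from Suc.IH[OF r(1)] obtain h where h: "eval f xs (h 0)"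
    "\<And>i. i < n \<Longrightarrow> eval g (h i # i # xs) (h (Suc i))" "h n = r" by blast
  then show ?case using r(2)
    by (auto intro!: exI[of _ "h(Suc n := v)"] simp: less_Suc_eq)
qed

text \<open>Register \<open>b\<close> counts the remaining rounds, \<open>b + 1\<close> holds the
  current value, \<open>b + 2\<close> the index and \<open>b + 3\<close> the value just computed;
  scratch space starts at \<open>b + 4\<close>.\<close>

lemma realizes_Prec:
  assumes f: "realizes f" and g: "realizes g"
  shows "realizes (Prec f g)"
  unfolding realizes_def
proof (intro allI impI)
  fix as out b xs v and \<sigma> :: "nat \<Rightarrow> nat"
  assume ev: "eval (Prec f g) xs v" and len: "length as = length xs" and out: "out < b"
    and args: "\<forall>i<length xs. as ! i < b \<and> as ! i \<noteq> out \<and> \<sigma> (as ! i) = xs ! i"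
  from ev obtain n ys where xs: "xs = n # ys" by (cases rule: eval.cases) auto
  with len obtain a as' where as: "as = a # as'" by (cases as) auto
  have a: "a < b" "a \<noteq> out" "\<sigma> a = n" using args xs as by auto
  have args': "as' ! i < b" "as' ! i \<noteq> out" "\<sigma> (as' ! i) = ys ! i" if "i < length ys" for i
    using args xs as that by (auto dest!: spec[of _ "Suc i"])
  have len': "length as' = length ys" using len xs as by auto
  from eval_Prec_trace ev xs obtain h where h: "eval f ys (h 0)"
    "\<And>i. i < n \<Longrightarrow> eval g (h i # i # ys) (h (Suc i))" "h n = v" by blast
  define \<sigma>1 where "\<sigma>1 = \<sigma>(b + 4 := 0, b := n)"
  define \<sigma>2 where "\<sigma>2 = \<sigma>1(b + 2 := 0)"
  have 1: "exec (CPY a b (b + 4)) \<sigma> \<sigma>1" "exec (CLR (b + 2)) \<sigma>1 \<sigma>2"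
    using exec_CPY[of a b "b + 4" \<sigma>] a unfolding \<sigma>1_def \<sigma>2_def by (auto intro: exec_CLR)
  have \<sigma>2: "\<sigma>2 j = \<sigma> j" if "j < b" for j using that by (auto simp: \<sigma>1_def \<sigma>2_def)
  have "\<exists>\<sigma>3. exec (compile f as' (b + 1) (b + 4)) \<sigma>2 \<sigma>3 \<and> \<sigma>3 (b + 1) = h 0 \<and>
    (\<forall>j < b + 4. j \<noteq> b + 1 \<longrightarrow> \<sigma>3 j = \<sigma>2 j)"
  proof (rule realizesD[OF f h(1) len'])
    show "as' ! i < b + 4 \<and> as' ! i \<noteq> b + 1 \<and> \<sigma>2 (as' ! i) = ys ! i" if "i < length ys" for i
      using args'[OF that] \<sigma>2 by auto
  qed auto
  then obtain \<sigma>3 where 3: "exec (compile f as' (b + 1) (b + 4)) \<sigma>2 \<sigma>3" "\<sigma>3 (b + 1) = h 0"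
    "\<And>j. j < b + 4 \<Longrightarrow> j \<noteq> b + 1 \<Longrightarrow> \<sigma>3 j = \<sigma>2 j" by blast
  define I where "I i s \<longleftrightarrow> s (b + 1) = h i \<and> s (b + 2) = i \<and> (\<forall>j < b. s j = \<sigma> j)" for i s
  let ?body = "SEQ (compile g ((b + 1) # (b + 2) # as') (b + 3) (b + 4))
                (SEQ (CPY (b + 3) (b + 1) (b + 4)) (INC (b + 2)))"
  have "\<exists>\<sigma>'. exec (LOOP b ?body) \<sigma>3 \<sigma>' \<and> I n \<sigma>'"
  proof (rule exec_LOOP_iterate)
    show "I 0 \<sigma>3" "\<sigma>3 b = n" using 3 \<sigma>2 by (auto simp: I_def \<sigma>2_def \<sigma>1_def)
  next
    fix i s assume i: "i < n" "I i s"
    let ?s = "s(b := n - Suc i)"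
    have "\<exists>s1. exec (compile g ((b + 1) # (b + 2) # as') (b + 3) (b + 4)) ?s s1 \<and>
      s1 (b + 3) = h (Suc i) \<and> (\<forall>j < b + 4. j \<noteq> b + 3 \<longrightarrow> s1 j = ?s j)"
    proof (rule realizesD[OF g h(2)[OF i(1)]])
      show "((b + 1) # (b + 2) # as') ! q < b + 4 \<and> ((b + 1) # (b + 2) # as') ! q \<noteq> b + 3 \<and>
         ?s (((b + 1) # (b + 2) # as') ! q) = (h i # i # ys) ! q"
        if "q < length (h i # i # ys)" for q
      proof (cases q)
        case (Suc q')
        then show ?thesis
        proof (cases q')
          case (Suc q'')
          then show ?thesis using \<open>q = Suc q'\<close> that args'[of q''] i(2) by (auto simp: I_def)
        qed (use Suc i(2) in \<open>auto simp: I_def\<close>)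
      qed (use i(2) in \<open>auto simp: I_def\<close>)
    qed (use len' in auto)
    then obtain s1 where s1: "exec (compile g ((b + 1) # (b + 2) # as') (b + 3) (b + 4)) ?s s1"
      "s1 (b + 3) = h (Suc i)" "\<And>j. j < b + 4 \<Longrightarrow> j \<noteq> b + 3 \<Longrightarrow> s1 j = ?s j" by blast
    define s2 where "s2 = s1(b + 4 := 0, b + 1 := s1 (b + 3))"
    define s3 where "s3 = s2(b + 2 := Suc (s2 (b + 2)))"
    have "exec (CPY (b + 3) (b + 1) (b + 4)) s1 s2" "exec (INC (b + 2)) s2 s3"
      unfolding s2_def s3_def by (rule exec_CPY exec_INC; simp)+
    then have "exec ?body ?s s3" using s1(1) by (blast intro: exec_SEQ)
    moreover have "I (Suc i) s3" "s3 b = n - Suc i"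
      using s1(2,3) i(2) by (auto simp: I_def s3_def s2_def)
    ultimately show "\<exists>s'. exec ?body ?s s' \<and> I (Suc i) s' \<and> s' b = n - Suc i" by blast
  qed
  then obtain \<sigma>4 where 4: "exec (LOOP b ?body) \<sigma>3 \<sigma>4" "I n \<sigma>4" by blast
  define \<sigma>5 where "\<sigma>5 = \<sigma>4(b + 4 := 0, out := \<sigma>4 (b + 1))"
  have 5: "exec (CPY (b + 1) out (b + 4)) \<sigma>4 \<sigma>5"
    unfolding \<sigma>5_def using out by (intro exec_CPY) auto
  have "exec (compile (Prec f g) as out b) \<sigma> \<sigma>5"
    using 1 3(1) 4(1) 5 unfolding as by (auto intro: exec_SEQ)
  moreover have "\<sigma>5 out = v" "\<forall>j<b. j \<noteq> out \<longrightarrow> \<sigma>5 j = \<sigma> j"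
    using 4(2) h(3) by (auto simp: I_def \<sigma>5_def)
  ultimately show "\<exists>\<sigma>'. exec (compile (Prec f g) as out b) \<sigma> \<sigma>' \<and> \<sigma>' out = v \<and>
    (\<forall>j<b. j \<noteq> out \<longrightarrow> \<sigma>' j = \<sigma> j)" by blast
qed

text \<open>Register \<open>b\<close> holds the candidate and \<open>b + 1\<close> the value of
  \<open>f\<close> there. The body overwrites its own loop counter \<open>b + 1\<close>, so the
  induction is on the distance of the candidate from \<open>v\<close>.\<close>

lemma realizes_Mn:
  assumes f: "realizes f"
  shows "realizes (Mn f)"
  unfolding realizes_def
proof (intro allI impI)
  fix as out b xs v and \<sigma> :: "nat \<Rightarrow> nat"
  assume ev: "eval (Mn f) xs v" and len: "length as = length xs" and out: "out < b"
    and args: "\<forall>i<length xs. as ! i < b \<and> as ! i \<noteq> out \<and> \<sigma> (as ! i) = xs ! i"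
  from ev have v: "eval f (v # xs) 0" and "\<forall>i < v. \<exists>w. eval f (i # xs) w \<and> 0 < w"
    by (cases rule: eval.cases; auto)+
  then obtain h where h: "\<And>i. i < v \<Longrightarrow> eval f (i # xs) (h i) \<and> 0 < h i" by metis
  \<comment> \<open>\<open>h\<close> is specified only below \<open>v\<close>; the value 0 at
    \<open>v\<close> ends the loop.\<close>
  define h' where "h' = h(v := 0)"
  have h': "eval f (i # xs) (h' i)" if "i \<le> v" for i
    using h[of i] v that by (auto simp: h'_def)
  define I where "I i s \<longleftrightarrow> s b = i \<and> s (b + 1) = h' i \<and> (\<forall>j < b. s j = \<sigma> j)" for i and s :: "nat \<Rightarrow> nat"
  have f_step: "\<exists>s'. exec (compile f (b # as) (b + 1) (b + 2)) s s' \<and> I i s'"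
    if "i \<le> v" "s b = i" "\<forall>j < b. s j = \<sigma> j" for i s
  proof -
    have "\<exists>s'. exec (compile f (b # as) (b + 1) (b + 2)) s s' \<and> s' (b + 1) = h' i \<and>
      (\<forall>j < b + 2. j \<noteq> b + 1 \<longrightarrow> s' j = s j)"
    proof (rule realizesD[OF f h'[OF that(1)]])
      show "(b # as) ! q < b + 2 \<and> (b # as) ! q \<noteq> b + 1 \<and> s ((b # as) ! q) = (i # xs) ! q"
        if "q < length (i # xs)" for q
      proof (cases q)
        case 0
        with \<open>s b = i\<close> show ?thesis by simp
      next
        case (Suc q')
        then have "as ! q' < b" "\<sigma> (as ! q') = xs ! q'" using args that by auto
        with Suc \<open>\<forall>j < b. s j = \<sigma> j\<close> show ?thesis by simp
      qed
    qed (use len in auto)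
    then obtain s' where "exec (compile f (b # as) (b + 1) (b + 2)) s s'" "s' (b + 1) = h' i"
      "\<And>j. j < b + 2 \<Longrightarrow> j \<noteq> b + 1 \<Longrightarrow> s' j = s j" by blast
    moreover from this have "I i s'" using that by (simp add: I_def)
    ultimately show ?thesis by blast
  qed
  let ?body = "SEQ (INC b) (compile f (b # as) (b + 1) (b + 2))"
  have loop: "\<exists>s'. exec (LOOP (b + 1) ?body) s s' \<and> I v s'" if "I (v - j) s" "j \<le> v" for j s
    using that
  proof (induction j arbitrary: s)
    case 0
    then show ?case using exec_LOOP_0[of s "b + 1"] by (auto simp: I_def h'_def)
  next
    case (Suc j)
    let ?i = "v - Suc j"
    have "0 < h' ?i" using h[of ?i] Suc.prems(2) by (auto simp: h'_def)
    then obtain m where m: "s (b + 1) = Suc m" using Suc.prems(1) by (auto simp: I_def gr0_conv_Suc)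
    let ?s = "(s(b + 1 := m))(b := Suc ((s(b + 1 := m)) b))"
    have "\<exists>s'. exec (compile f (b # as) (b + 1) (b + 2)) ?s s' \<and> I (v - j) s'"
      using Suc.prems by (intro f_step) (auto simp: I_def)
    then obtain s' where s': "exec (compile f (b # as) (b + 1) (b + 2)) ?s s'" "I (v - j) s'" by blast
    then have "exec ?body (s(b + 1 := m)) s'" by (blast intro: exec_SEQ exec_INC)
    moreover obtain s'' where "exec (LOOP (b + 1) ?body) s' s''" "I v s''"
      using Suc.IH[OF s'(2)] Suc.prems by auto
    ultimately show ?case using exec_LOOP_Suc[of s "b + 1" m, OF m] by blast
  qed
  define \<sigma>1 where "\<sigma>1 = \<sigma>(b := 0)"
  have "\<exists>s'. exec (compile f (b # as) (b + 1) (b + 2)) \<sigma>1 s' \<and> I 0 s'"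
    by (rule f_step) (auto simp: \<sigma>1_def)
  then obtain \<sigma>2 where 2: "exec (compile f (b # as) (b + 1) (b + 2)) \<sigma>1 \<sigma>2" "I 0 \<sigma>2" by blast
  obtain \<sigma>3 where 3: "exec (LOOP (b + 1) ?body) \<sigma>2 \<sigma>3" "I v \<sigma>3"
    using loop[of v \<sigma>2] 2(2) by auto
  define \<sigma>4 where "\<sigma>4 = \<sigma>3(b + 2 := 0, out := \<sigma>3 b)"
  have "exec (CPY b out (b + 2)) \<sigma>3 \<sigma>4"
    unfolding \<sigma>4_def using out by (intro exec_CPY) auto
  moreover have "exec (CLR b) \<sigma> \<sigma>1" unfolding \<sigma>1_def by (rule exec_CLR)
  ultimately have "exec (compile (Mn f) as out b) \<sigma> \<sigma>4"
    using 2(1) 3(1) by (auto intro: exec_SEQ)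
  moreover have "\<sigma>4 out = v" "\<forall>j<b. j \<noteq> out \<longrightarrow> \<sigma>4 j = \<sigma> j"
    using 3(2) by (auto simp: I_def \<sigma>4_def)
  ultimately show "\<exists>\<sigma>'. exec (compile (Mn f) as out b) \<sigma> \<sigma>' \<and> \<sigma>' out = v \<and>
    (\<forall>j<b. j \<noteq> out \<longrightarrow> \<sigma>' j = \<sigma> j)" by blast
qed

lemma realizes_Comp:
  assumes f: "realizes f" and gs: "\<And>g. g \<in> set gs \<Longrightarrow> realizes g"
  shows "realizes (Comp f gs)"
  unfolding realizes_def
proof (intro allI impI)
  fix as out b xs v and \<sigma> :: "nat \<Rightarrow> nat"
  assume ev: "eval (Comp f gs) xs v" and len: "length as = length xs" and out: "out < b"
    and args: "\<forall>i<length xs. as ! i < b \<and> as ! i \<noteq> out \<and> \<sigma> (as ! i) = xs ! i"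
  from ev obtain ys where ys: "length ys = length gs" "\<forall>i < length gs. eval (gs ! i) xs (ys ! i)"
    "eval f ys v" by (cases rule: eval.cases) auto
  obtain \<sigma>1 where 1: "exec (compile_list gs as b (b + length gs)) \<sigma> \<sigma>1"
    "\<And>i. i < length gs \<Longrightarrow> \<sigma>1 (b + i) = ys ! i" "\<And>j. j < b \<Longrightarrow> \<sigma>1 j = \<sigma> j"
    using compile_list_realizes[OF gs ys(1,2) len, of b "b + length gs" \<sigma>] args by auto
  have "\<exists>\<sigma>2. exec (compile f [b..<b + length gs] out (b + length gs)) \<sigma>1 \<sigma>2 \<and> \<sigma>2 out = v \<and>
    (\<forall>j < b + length gs. j \<noteq> out \<longrightarrow> \<sigma>2 j = \<sigma>1 j)"
    using ys(1) out 1(2) by (intro realizesD[OF f ys(3)]) auto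
  then obtain \<sigma>2 where "exec (compile f [b..<b + length gs] out (b + length gs)) \<sigma>1 \<sigma>2" "\<sigma>2 out = v"
    "\<And>j. j < b + length gs \<Longrightarrow> j \<noteq> out \<Longrightarrow> \<sigma>2 j = \<sigma>1 j" by blast
  with 1 show "\<exists>\<sigma>'. exec (compile (Comp f gs) as out b) \<sigma> \<sigma>' \<and> \<sigma>' out = v \<and>
    (\<forall>j<b. j \<noteq> out \<longrightarrow> \<sigma>' j = \<sigma> j)"
    by (auto intro!: exI[of _ \<sigma>2] exec_SEQ)
qed

lemma realizes: "realizes r"
proof (induction r)
  case Zero
  then show ?case
    unfolding realizes_def by (auto elim!: eval.cases intro!: exI exec_CLR)
next
  case Succ
  show ?case unfolding realizes_def
  proof (intro allI impI)
    fix as out b xs v and \<sigma> :: "nat \<Rightarrow> nat"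
    assume ev: "eval Succ xs v" and len: "length as = length xs" and out: "out < b"
      and args: "\<forall>i<length xs. as ! i < b \<and> as ! i \<noteq> out \<and> \<sigma> (as ! i) = xs ! i"
    from ev obtain x ys where xs: "xs = x # ys" "v = Suc x" by (cases rule: eval.cases) auto
    then have a: "as ! 0 < b" "as ! 0 \<noteq> out" "\<sigma> (as ! 0) = x" using args by auto
    have big: "exec (compile Succ as out b) \<sigma> ((\<sigma>(b := 0, out := \<sigma> (as ! 0)))(out := Suc ((\<sigma>(b := 0, out := \<sigma> (as ! 0))) out)))"
      unfolding compile.simps by (rule exec_SEQ[OF exec_CPY exec_INC]) (use a out in auto)
    show "\<exists>\<sigma>'. exec (compile Succ as out b) \<sigma> \<sigma>' \<and> \<sigma>' out = v \<and> (\<forall>j<b. j \<noteq> out \<longrightarrow> \<sigma>' j = \<sigma> j)"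
      by (rule exI, intro conjI, rule big) (use a xs in auto)
  qed
next
  case (Proj i)
  show ?case unfolding realizes_def
  proof (intro allI impI)
    fix as out b xs v and \<sigma> :: "nat \<Rightarrow> nat"
    assume ev: "eval (Proj i) xs v" and len: "length as = length xs" and out: "out < b"
      and args: "\<forall>i<length xs. as ! i < b \<and> as ! i \<noteq> out \<and> \<sigma> (as ! i) = xs ! i"
    from ev have "i < length xs" "v = xs ! i" by (cases rule: eval.cases; auto)+
    then have a: "as ! i < b" "as ! i \<noteq> out" "\<sigma> (as ! i) = v" using args by auto
    have big: "exec (compile (Proj i) as out b) \<sigma> (\<sigma>(b := 0, out := \<sigma> (as ! i)))"
      using a out by (auto intro!: exec_CPY)
    show "\<exists>\<sigma>'. exec (compile (Proj i) as out b) \<sigma> \<sigma>' \<and> \<sigma>' out = v \<and> (\<forall>j<b. j \<noteq> out \<longrightarrow> \<sigma>' j = \<sigma> j)"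
      by (rule exI, intro conjI, rule big) (use a in auto)
  qed
qed (auto intro: realizes_Comp realizes_Prec realizes_Mn)

section \<open>Counter machine programs with jumps\<close>

datatype instr = Inc nat nat | Dec nat nat nat

fun step :: "instr list \<Rightarrow> nat \<times> (nat \<Rightarrow> nat) \<Rightarrow> nat \<times> (nat \<Rightarrow> nat)" where
  "step P (pc, \<sigma>) =
     (if pc < length P then
        (case P ! pc of
           Inc k l \<Rightarrow> (l, \<sigma>(k := Suc (\<sigma> k)))
         | Dec k l l' \<Rightarrow> if \<sigma> k = 0 then (l', \<sigma>) else (l, \<sigma>(k := \<sigma> k - 1)))
      else (pc, \<sigma>))"

fun cmd_length :: "cmd \<Rightarrow> nat" where
  "cmd_length (INC k) = 1"
| "cmd_length (DEC k) = 1"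
| "cmd_length (SEQ c d) = cmd_length c + cmd_length d"
| "cmd_length (LOOP k c) = Suc (cmd_length c)"

text \<open>\<open>flatten c n ex\<close> is to be placed at address \<open>n\<close> and leaves to address \<open>ex\<close>.\<close>
fun flatten :: "cmd \<Rightarrow> nat \<Rightarrow> nat \<Rightarrow> instr list" where
  "flatten (INC k) n ex = [Inc k ex]"
| "flatten (DEC k) n ex = [Dec k ex ex]"
| "flatten (SEQ c d) n ex = flatten c n (n + cmd_length c) @ flatten d (n + cmd_length c) ex"
| "flatten (LOOP k c) n ex = Dec k (Suc n) ex # flatten c (Suc n) n"

lemma length_flatten [simp]: "length (flatten c n ex) = cmd_length c"
  by (induction c arbitrary: n ex) auto

text \<open>Induction on the execution, since a loop contains itself as a subexecution. Jump targets
  are absolute, so \<open>P\<close> stays whole and only its decomposition around the code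
  varies.\<close>

lemma flatten_correct:
  assumes "exec c \<sigma> \<sigma>'"
  shows "P = pre @ flatten c (length pre) ex @ post \<Longrightarrow> \<exists>m. (step P ^^ m) (length pre, \<sigma>) = (ex, \<sigma>')"
  using assms
proof (induction arbitrary: pre ex post rule: exec.induct)
  case (exec_INC k \<sigma>)
  then show ?case by (intro exI[of _ 1]) (simp add: fun_eq_iff)
next
  case (exec_DEC k \<sigma>)
  then show ?case by (intro exI[of _ 1]) (simp add: fun_eq_iff)
next
  case (exec_SEQ c \<sigma> \<sigma>1 d \<sigma>2)
  let ?l = "length pre + cmd_length c"
  obtain m1 where 1: "(step P ^^ m1) (length pre, \<sigma>) = (?l, \<sigma>1)"
    using exec_SEQ.IH(1)[of pre ?l] exec_SEQ.prems by auto
  obtain m2 where 2: "(step P ^^ m2) (?l, \<sigma>1) = (ex, \<sigma>2)"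
    using exec_SEQ.IH(2)[of "pre @ flatten c (length pre) ?l" ex post] exec_SEQ.prems by auto
  show ?case by (intro exI[of _ "m2 + m1"]) (simp add: funpow_add 1 2 del: step.simps)
next
  case (exec_LOOP_0 \<sigma> k c)
  then show ?case by (intro exI[of _ 1]) simp
next
  case (exec_LOOP_Suc \<sigma> k m c \<sigma>1 \<sigma>2)
  have 0: "step P (length pre, \<sigma>) = (Suc (length pre), \<sigma>(k := m))"
    using exec_LOOP_Suc by simp
  obtain m1 where 1: "(step P ^^ m1) (Suc (length pre), \<sigma>(k := m)) = (length pre, \<sigma>1)"
    using exec_LOOP_Suc.IH(1)[of "pre @ [Dec k (Suc (length pre)) ex]" "length pre" post]
      exec_LOOP_Suc.prems by (auto simp del: step.simps fun_upd_apply)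
  obtain m2 where 2: "(step P ^^ m2) (length pre, \<sigma>1) = (ex, \<sigma>2)"
    using exec_LOOP_Suc.IH(2)[of pre ex post] exec_LOOP_Suc.prems by blast
  have "(step P ^^ (m2 + Suc m1)) (length pre, \<sigma>)
      = (step P ^^ m2) ((step P ^^ m1) (step P (length pre, \<sigma>)))"
    by (simp add: funpow_add funpow_swap1 del: step.simps)
  also have "\<dots> = (ex, \<sigma>2)" by (simp only: 0 1 2)
  finally show ?case ..
qed

text \<open>Counter 0 starts at \<open>Suc x\<close>, so its marker never travels with the initial
  program counter and the border cell treats all inputs alike.\<close>

definition init :: "nat \<Rightarrow> nat \<times> (nat \<Rightarrow> nat)" where
  "init x = (0, (\<lambda>_. 0)(0 := Suc x))"

definition halts :: "instr list \<Rightarrow> nat \<Rightarrow> bool" where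
  "halts P x \<longleftrightarrow> (\<exists>m. length P \<le> fst ((step P ^^ m) (init x)))"

text \<open>The leading \<open>DEC 0\<close> undoes the offset of \<open>init\<close>. The
  instruction appended at address \<open>L\<close> leaves the program if the result in register 1 is
  nonzero and otherwise jumps to itself.\<close>

lemma compile_recf:
  "\<exists>P. \<forall>x v. eval r [x] v \<longrightarrow> (halts P x \<longleftrightarrow> v \<noteq> 0)"
proof -
  define c where "c = SEQ (DEC 0) (compile r [0] 1 2)"
  define L where "L = cmd_length c"
  define P where "P = [] @ flatten c (length ([] :: instr list)) L @ [Dec 1 (Suc L) L]"
  have len: "length P = Suc L" and PL: "P ! L = Dec 1 (Suc L) L"
    by (simp_all add: P_def L_def nth_append)
  have "halts P x \<longleftrightarrow> v \<noteq> 0" if ev: "eval r [x] v" for x v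
  proof -
    let ?\<sigma> = "(\<lambda>_. 0)(0 := Suc x) :: nat \<Rightarrow> nat"
    have "exec (DEC 0) ?\<sigma> (?\<sigma>(0 := ?\<sigma> 0 - 1))" by (rule exec_DEC)
    moreover have "\<exists>\<sigma>'. exec (compile r [0] 1 2) (?\<sigma>(0 := ?\<sigma> 0 - 1)) \<sigma>' \<and> \<sigma>' 1 = v
      \<and> (\<forall>j < 2. j \<noteq> 1 \<longrightarrow> \<sigma>' j = (?\<sigma>(0 := ?\<sigma> 0 - 1)) j)"
      by (rule realizesD[OF realizes ev]) auto
    then obtain \<sigma>' where "exec (compile r [0] 1 2) (?\<sigma>(0 := ?\<sigma> 0 - 1)) \<sigma>'" and v: "\<sigma>' 1 = v"
      by blast
    ultimately have "exec c ?\<sigma> \<sigma>'" unfolding c_def by (blast intro: exec_SEQ)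
    from flatten_correct[OF this P_def] obtain m where m: "(step P ^^ m) (init x) = (L, \<sigma>')"
      by (auto simp: init_def)
    show ?thesis
    proof (cases "v = 0")
      case False
      then have "(step P ^^ Suc m) (init x) = (Suc L, \<sigma>'(1 := v - 1))"
        using m len PL v by simp
      then show ?thesis using False len unfolding halts_def by (metis fst_conv order_refl)
    next
      case True
      then have loop: "step P (L, \<sigma>') = (L, \<sigma>')" using len PL v by simp
      have "fst ((step P ^^ i) (init x)) < length P" for i
      proof (rule ccontr)
        assume *: "\<not> fst ((step P ^^ i) (init x)) < length P"
        obtain pc \<tau> where i: "(step P ^^ i) (init x) = (pc, \<tau>)" by fastforce
        \<comment> \<open>A halted configuration and \<open>(L, \<sigma>')\<close> are both fixed by
          \<open>step\<close>, so a run that reaches both would make them equal.\<close>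
        have "step P (pc, \<tau>) = (pc, \<tau>)" using * i by simp
        then have "(step P ^^ m) (pc, \<tau>) = (pc, \<tau>)" by (induction m) auto
        moreover have "(step P ^^ i) (L, \<sigma>') = (L, \<sigma>')" using loop by (induction i) auto
        ultimately have "(pc, \<tau>) = (L, \<sigma>')"
          using i m by (metis add.commute comp_apply funpow_add)
        then show False using * i len by simp
      qed
      then show ?thesis using True unfolding halts_def by (metis not_less)
    qed
  qed
  then show ?thesis by blast
qed

section \<open>The cellular automaton of a counter machine\<close>

text \<open>
  \<open>Cf po ms\<close> carries the program counter, if it passes at this moment, and the set of counters whose markers
  pass at this moment; \<open>MC\<close> is the initial message of the cells with letter \<open>c\<close>, and \<open>MH\<close> the boundary signal.

  Letters are \<open>LA\<close> and \<open>LC\<close>; \<open>B0\<close> and \<open>Ch\<close> are the states of the border cell while it emits the initial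
  configuration. A cell in state \<open>Wk D po ms pp pm un\<close> performs a machine step that delays the
  markers in \<open>D\<close> by an extra time unit; it sends \<open>po\<close> and \<open>ms\<close> now and \<open>pp\<close> and \<open>pm\<close> one step later, and
  \<open>un\<close> is the set of markers that have not yet arrived.
\<close>
datatype msg = MC | MH | Cf "nat option" "nat set"

datatype st = LA | LC | W | CI | HC | Acc | Dead | HD | B0 | Ch nat
  | Wk "nat set" "nat option" "nat set" "nat option" "nat set" "nat set"

text \<open>The next program counter, the markers to delay, and whether the program counter is delayed.\<close>
definition action :: "instr list \<Rightarrow> nat set \<Rightarrow> nat \<Rightarrow> nat set \<Rightarrow> nat \<times> nat set \<times> bool" where
  "action P K pc Z = (case P ! pc of
     Inc k l \<Rightarrow> (l, {k}, False)
   | Dec k l l' \<Rightarrow> if k \<in> Z then (l', {}, False) else (l, K - {k}, True))"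

text \<open>The markers \<open>Z\<close> arriving with the program counter are those of the zero
  counters. They leave now or, if in \<open>D\<close>, one step later; those in \<open>K - Z\<close>
  are still awaited.\<close>

definition start :: "instr list \<Rightarrow> nat set \<Rightarrow> nat \<Rightarrow> nat set \<Rightarrow> st" where
  "start P K pc Z = (if length P \<le> pc then HD else case action P K pc Z of (l, D, d) \<Rightarrow>
     Wk D (if d then None else Some l) (Z - D) (if d then Some l else None) (Z \<inter> D) (K - Z))"

definition message :: "nat option \<Rightarrow> nat set \<Rightarrow> msg option" where
  "message po ms = (if po = None \<and> ms = {} then None else Some (Cf po ms))"

text \<open>The border cell sends the program counter with all markers except that of counter 0,
  which follows \<open>x + 1\<close> steps later and so codes the value
  \<open>Suc x\<close>.\<close>

fun send :: "nat set \<Rightarrow> nat \<Rightarrow> st \<Rightarrow> msg option" where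
  "send K x LC = Some MC"
| "send K x HC = Some MH"
| "send K x Acc = Some MH"
| "send K x B0 = Some (Cf (Some 0) (K - {0}))"
| "send K x (Ch j) = (if j = x then Some (Cf None {0}) else None)"
| "send K x (Wk D po ms pp pm un) = message po ms"
| "send K x _ = None"

text \<open>The border cell ends as a worker with nothing to send or await, which still relays the
  boundary signal.\<close>

definition idle :: st where
  "idle = Wk {} None {} None {} {}"

text \<open>The first step checks the letters: \<open>LC\<close> dies if its right neighbour is
  \<open>LA\<close>, and \<open>LA\<close> dies at the right end. Intersecting with \<open>K\<close>
  and \<open>un\<close> keeps the state set finite and counts each marker at most once, whatever
  arrives.\<close>

fun delta :: "instr list \<Rightarrow> nat set \<Rightarrow> nat \<Rightarrow> st \<Rightarrow> msg option \<Rightarrow> st" where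
  "delta P K x LA None = W"
| "delta P K x LA (Some MC) = B0"
| "delta P K x LC (Some MC) = CI"
| "delta P K x LC (Some MH) = HC"
| "delta P K x CI None = CI"
| "delta P K x CI (Some MH) = HC"
| "delta P K x W None = W"
| "delta P K x W (Some (Cf (Some pc) Z)) = start P K pc (Z \<inter> K)"
| "delta P K x HD (Some MH) = Acc"
| "delta P K x HD _ = HD"
| "delta P K x B0 _ = Ch 0"
| "delta P K x (Ch j) _ = (if j < x then Ch (Suc j) else idle)"
| "delta P K x (Wk D po ms pp pm un) None = Wk D pp pm None {} un"
| "delta P K x (Wk D po ms pp pm un) (Some (Cf q Y)) =
     Wk D pp (pm \<union> (Y \<inter> un - D)) None (Y \<inter> un \<inter> D) (un - Y)"
| "delta P K x (Wk D po ms pp pm un) (Some MH) = HC"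
| "delta P K x _ _ = Dead"

fun regs :: "instr \<Rightarrow> nat set" where
  "regs (Inc k l) = {k}" | "regs (Dec k l l') = {k}"

fun labels :: "instr \<Rightarrow> nat set" where
  "labels (Inc k l) = {l}" | "labels (Dec k l l') = {l, l'}"

definition allregs :: "instr list \<Rightarrow> nat set" where
  "allregs P = insert 0 (\<Union>(regs ` set P))"

definition alllabels :: "instr list \<Rightarrow> nat set" where
  "alllabels P = insert 0 (\<Union>(labels ` set P))"

lemma finite_regs: "finite (allregs P)" "finite (alllabels P)"
proof -
  have "finite (regs i)" "finite (labels i)" for i by (cases i; simp)+
  then show "finite (allregs P)" "finite (alllabels P)"
    unfolding allregs_def alllabels_def by auto
qed

definition opts :: "nat set \<Rightarrow> nat option set" where
  "opts Q = insert None (Some ` Q)"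

text \<open>The part of the state set that is independent of \<open>x\<close>; only the chain states
  come on top.\<close>

definition base_states :: "instr list \<Rightarrow> st set" where
  "base_states P = {LA, LC, W, CI, HC, Acc, Dead, HD, B0} \<union>
     (\<lambda>(D, po, ms, pp, pm, un). Wk D po ms pp pm un) `
       (Pow (allregs P) \<times> opts (alllabels P) \<times> Pow (allregs P) \<times>
        opts (alllabels P) \<times> Pow (allregs P) \<times> Pow (allregs P))"

definition msgs :: "instr list \<Rightarrow> msg set" where
  "msgs P = {MC, MH} \<union> (\<lambda>(po, ms). Cf po ms) ` (opts (alllabels P) \<times> Pow (allregs P))"

lemma finite_base_states: "finite (base_states P)" and finite_msgs: "finite (msgs P)"
  unfolding base_states_def msgs_def opts_def using finite_regs[of P] by auto

lemma Wk_base: "Wk D po ms pp pm un \<in> base_states P \<longleftrightarrow> D \<subseteq> allregs P \<and> po \<in> opts (alllabels P) \<and>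
  ms \<subseteq> allregs P \<and> pp \<in> opts (alllabels P) \<and> pm \<subseteq> allregs P \<and> un \<subseteq> allregs P"
  unfolding base_states_def by (auto intro!: image_eqI[where x = "(D, po, ms, pp, pm, un)"])

lemma Ch_base: "Ch j \<notin> base_states P"
  unfolding base_states_def by auto

lemma action_closed:
  assumes "pc < length P" "action P (allregs P) pc Z = (l, D, d)"
  shows "l \<in> alllabels P \<and> D \<subseteq> allregs P"
proof -
  have "regs (P ! pc) \<subseteq> allregs P" "labels (P ! pc) \<subseteq> alllabels P"
    using assms(1) nth_mem unfolding allregs_def alllabels_def by blast+
  then show ?thesis
    using assms(2) by (auto simp: action_def split: instr.splits if_splits)
qed

lemma start_base_states: "Z \<subseteq> allregs P \<Longrightarrow> start P (allregs P) pc Z \<in> base_states P"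
proof (cases "length P \<le> pc")
  case True
  then show ?thesis by (simp add: start_def base_states_def)
next
  case False
  obtain l D d where a: "action P (allregs P) pc Z = (l, D, d)" by (metis prod_cases3)
  assume "Z \<subseteq> allregs P"
  then show ?thesis
    using False action_closed[OF _ a] unfolding start_def a by (auto simp: Wk_base opts_def)
qed

abbreviation states :: "instr list \<Rightarrow> nat \<Rightarrow> st set" where
  "states P x \<equiv> base_states P \<union> Ch ` {..x}"

lemma delta_states: "s \<in> states P x \<Longrightarrow> delta P (allregs P) x s y \<in> states P x"
  by (induction P "allregs P" x s y rule: delta.induct)
     (auto simp: Wk_base start_base_states idle_def opts_def, auto simp: base_states_def)

text \<open>Only chain states look at \<open>x\<close>, so the table for all other states is written
  once, with the dummy 0.\<close>

lemma delta_base: "s \<in> base_states P \<Longrightarrow> delta P K x s y = delta P K 0 s y"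
  by (induction P K x s y rule: delta.induct) (auto simp: Ch_base)

lemma send_msgs: "s \<in> states P x \<Longrightarrow> send (allregs P) x s = Some m \<Longrightarrow> m \<in> msgs P"
  by (induction "allregs P" x s rule: send.induct)
     (auto simp: message_def msgs_def opts_def allregs_def alllabels_def Wk_base split: if_splits)

text \<open>An upper bound on the number of messages that a cell still sends.\<close>
fun potential :: "nat set \<Rightarrow> st \<Rightarrow> nat" where
  "potential K LA = card K + 4"
| "potential K W = card K + 2"
| "potential K LC = 2"
| "potential K B0 = 3"
| "potential K (Ch j) = 2"
| "potential K (Wk D po ms pp pm un) =
     1 + (if po = None then 0 else 1) + card ms + (if pp = None then 0 else 1) + card pm + card un"
| "potential K Dead = 0"
| "potential K _ = 1"

lemma potential_start:
  assumes "finite K" "Z \<subseteq> K"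
  shows "potential K (start P K pc Z) \<le> card K + 2"
proof -
  have fZ: "finite Z" using assms finite_subset by blast
  have "card (Z - D) + card (Z \<inter> D) = card Z" for D
    using card_Int_Diff[OF fZ, of D] by linarith
  moreover have "card (K - Z) + card Z = card K"
    using assms card_mono[OF assms] by (simp add: card_Diff_subset fZ)
  ultimately have "card (Z - D) + card (Z \<inter> D) + card (K - Z) = card K" for D
    by (metis add.commute)
  note * = this
  show ?thesis
    unfolding start_def by (auto split: prod.splits) (use * in \<open>metis add.commute add.assoc le_refl\<close>)+
qed

lemma message_le:
  "finite ms \<Longrightarrow> (if message po ms = None then 0 else 1) \<le> (if po = None then 0 else 1) + card ms"
  by (auto simp: message_def Suc_le_eq card_gt_0_iff)

text \<open>Each message uses up a program counter, a marker, the boundary signal or a constant of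
  an early state; an arriving marker only moves from \<open>un\<close> to a set of outgoing
  ones.\<close>

lemma potential_delta:
  assumes "s \<in> states P x" "K = allregs P"
  shows "potential K (delta P K x s y) + (if send K x s = None then 0 else 1) \<le> potential K s"
  using assms
proof (induction P K x s y rule: delta.induct)
  case (8 P K x pc Z)
  then show ?case using potential_start[of K "Z \<inter> K" P pc] finite_regs by auto
next
  case (13 P K x D po ms pp pm un)
  then have "finite ms" using finite_regs[of P] finite_subset by (auto simp: Wk_base)
  then show ?case using message_le[of ms po] by (auto split: if_splits)
next
  case (14 P K x D po ms pp pm un q Y)
  then have fin: "finite ms" "finite un" "finite pm"
    using finite_regs[of P] finite_subset by (auto simp: Wk_base)
  have "card un = card (un \<inter> Y) + card (un - Y)"
    "card (un \<inter> Y) = card (un \<inter> Y \<inter> D) + card (un \<inter> Y - D)"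
    using fin by (auto intro!: card_Int_Diff)
  then have "card un = card (Y \<inter> un - D) + card (Y \<inter> un \<inter> D) + card (un - Y)"
    by (simp add: Int_commute)
  moreover have "card (pm \<union> (Y \<inter> un - D)) \<le> card pm + card (Y \<inter> un - D)" by (rule card_Un_le)
  ultimately have "card (pm \<union> (Y \<inter> un - D)) + card (Y \<inter> un \<inter> D) + card (un - Y) \<le> card pm + card un"
    by linarith
  then show ?case using message_le[OF fin(1), of po] by (auto split: if_splits)
next
  case (15 P K x D po ms pp pm un)
  then have "finite ms" using finite_regs[of P] finite_subset by (auto simp: Wk_base)
  then show ?case using message_le[of ms po] by (auto split: if_splits)
next
  case (12 P K x j)
  then show ?case by (auto simp: idle_def)
qed (auto simp: message_def)

primrec arun :: "instr list \<Rightarrow> nat \<Rightarrow> st list \<Rightarrow> nat \<Rightarrow> nat \<Rightarrow> st" where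
  "arun P x v 0 = (\<lambda>i. v ! (i - 1))"
| "arun P x v (Suc t) = (\<lambda>i. delta P (allregs P) x (arun P x v t i)
      (if i < length v then send (allregs P) x (arun P x v t (Suc i)) else if t = 0 then Some MH else None))"

lemma arun_states:
  assumes "set v \<subseteq> {LA, LC}" "1 \<le> i" "i \<le> length v"
  shows "arun P x v t i \<in> states P x"
proof (induction t)
  case 0
  have "v ! (i - 1) \<in> set v" using assms by auto
  then show ?case using assms(1) by (auto simp: base_states_def)
next
  case (Suc t)
  then show ?case by (simp only: arun.simps delta_states)
qed

text \<open>Messages sent so far plus remaining potential never increase. The resulting bound
  depends on \<open>P\<close> alone, so it serves both communication measures.\<close>

lemma arun_send_card:
  assumes "set v \<subseteq> {LA, LC}" "1 \<le> i" "i \<le> length v"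
  shows "card {j. j < t \<and> send (allregs P) x (arun P x v j i) \<noteq> None} \<le> card (allregs P) + 4"
proof -
  let ?S = "\<lambda>t. {j. j < t \<and> send (allregs P) x (arun P x v j i) \<noteq> None}"
  have "card (?S t) + potential (allregs P) (arun P x v t i) \<le> potential (allregs P) (arun P x v 0 i)" for t
  proof (induction t)
    case (Suc t)
    let ?b = "if send (allregs P) x (arun P x v t i) = None then 0 else 1 :: nat"
    have "?S (Suc t) = (if send (allregs P) x (arun P x v t i) = None then ?S t else insert t (?S t))"
      by (auto simp: less_Suc_eq simp del: arun.simps)
    then have "card (?S (Suc t)) = card (?S t) + ?b"
      by (simp del: arun.simps)
    moreover have "potential (allregs P) (arun P x v (Suc t) i) + ?b \<le> potential (allregs P) (arun P x v t i)"
      unfolding arun.simps by (rule potential_delta[OF arun_states[OF assms] refl])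
    ultimately show ?case using Suc by linarith
  qed simp
  moreover have "v ! (i - 1) \<in> set v" using assms by auto
  then have "potential (allregs P) (arun P x v 0 i) \<le> card (allregs P) + 4" using assms(1) by auto
  ultimately show ?thesis by (meson add_leD1 le_trans)
qed

section \<open>The boundary signal and the shape of accepted inputs\<close>

lemma send_MH: "send K x s = Some MH \<Longrightarrow> s = HC \<or> s = Acc"
  by (cases s) (auto simp: message_def split: if_splits)

lemma start_neq: "start P K pc Z \<noteq> Acc" "start P K pc Z \<noteq> HC"
  unfolding start_def by (simp_all split: prod.split)

lemma delta_Acc: "delta P K x s y = Acc \<Longrightarrow> s = HD \<and> y = Some MH"
  by (induction P K x s y rule: delta.induct) (simp_all add: start_neq idle_def split: if_splits)

lemma delta_HC: "delta P K x s y = HC \<Longrightarrow> y = Some MH \<and> s \<noteq> LA \<and> s \<noteq> HC"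
  by (induction P K x s y rule: delta.induct) (simp_all add: start_neq idle_def split: if_splits)

text \<open>Cells with letter \<open>LC\<close> take no part in the simulation; being in
  \<open>CI\<close> certifies that the next letter is \<open>LC\<close> as well.\<close>

lemma arun_LC:
  assumes "set v \<subseteq> {LA, LC}" "1 \<le> i" "i \<le> length v" "v ! (i - 1) = LC" "1 \<le> t"
  shows "arun P x v t i \<in> {CI, HC, Dead} \<and> (arun P x v t i = CI \<longrightarrow> i < length v \<and> v ! i = LC)"
  using assms(5)
proof (induction t rule: dec_induct)
  case base
  show ?case
  proof (cases "i < length v")
    case True
    then have "v ! i = LA \<or> v ! i = LC" using assms(1) nth_mem by blast
    then show ?thesis using True assms(4) by auto
  qed (use assms(4) in simp)
next
  case (step t)
  have *: "delta P K x s y \<in> {CI, HC, Dead} \<and> (delta P K x s y = CI \<longrightarrow> s = CI)"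
    if "s \<in> {CI, HC, Dead}" for K s y
    using that by (cases y; cases "the y") auto
  show ?case using step.IH * unfolding arun.simps by blast
qed

text \<open>The signal is traced back to the right end. It moves one cell per step, which fixes
  \<open>t + i\<close>, and every cell on its way certifies one more letter of the suffix.\<close>

lemma arun_HC_Acc:
  assumes "set v \<subseteq> {LA, LC}" "1 \<le> i" "i \<le> length v" "arun P x v t i \<in> {HC, Acc}"
  shows "t + i = Suc (length v) \<and> (\<exists>p q. drop (i - 1) v = replicate p LA @ replicate (Suc q) LC)"
  using assms(2-)
proof (induction t arbitrary: i)
  case 0
  then have "v ! (i - 1) \<in> {LA, LC}" using assms(1) nth_mem[of "i - 1" v] by fastforce
  then show ?case using 0 by auto
next
  case (Suc t)
  let ?s = "arun P x v t i"
  define y where "y = (if i < length v then send (allregs P) x (arun P x v t (Suc i))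
    else if t = 0 then Some MH else None)"
  have d: "delta P (allregs P) x ?s y \<in> {HC, Acc}" using Suc.prems by (simp add: y_def)
  then have y: "y = Some MH" using delta_Acc delta_HC by blast
  have v: "v ! (i - 1) = LA \<or> v ! (i - 1) = LC"
    using Suc.prems assms(1) nth_mem[of "i - 1" v] by fastforce
  have drop: "drop (i - 1) v = v ! (i - 1) # drop i v"
    using Suc.prems Cons_nth_drop_Suc[of "i - 1" v] by simp
  show ?case
  proof (cases "i < length v")
    case False
    then have "t = 0" "i = length v" using y Suc.prems by (auto simp: y_def split: if_splits)
    then show ?thesis using d y v drop by (auto intro!: exI[of _ 0])
  next
    case True
    then have "arun P x v t (Suc i) \<in> {HC, Acc}" using y send_MH by (fastforce simp: y_def)
    from Suc.IH[OF _ _ this] True obtain p q where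
      t: "t + i = length v" and pq: "drop i v = replicate p LA @ replicate (Suc q) LC" by auto
    have "1 \<le> t" using t True by simp
    show ?thesis
    proof (cases "v ! (i - 1) = LA")
      case True
      then have "drop (i - 1) v = replicate (Suc p) LA @ replicate (Suc q) LC" using drop pq by simp
      then show ?thesis using t by (metis add_Suc)
    next
      case False
      then have LC: "v ! (i - 1) = LC" using v by simp
      \<comment> \<open>Of the possible states of an \<open>LC\<close> cell only \<open>CI\<close>
        turns into \<open>HC\<close>, and it certifies the next letter; so no \<open>LA\<close>
        follows.\<close>
      from arun_LC[OF assms(1) Suc.prems(1,2) LC \<open>1 \<le> t\<close>, of P x] d y
      have "v ! i = LC" by auto
      then have "hd (drop i v) = LC" using True by (simp add: hd_drop_conv_nth)
      then have "p = 0" unfolding pq by (cases p) auto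
      then have "drop (i - 1) v = replicate 0 LA @ replicate (Suc (Suc q)) LC" using drop pq LC by simp
      then show ?thesis using t by (metis add_Suc)
    qed
  qed
qed

text \<open>The run of the cell \<open>d\<close> positions left of the border between the two blocks, as long as
  it is not reached by the boundary signal.\<close>
fun ideal :: "instr list \<Rightarrow> nat \<Rightarrow> nat \<Rightarrow> nat \<Rightarrow> st" where
  "ideal P x d 0 = LA"
| "ideal P x 0 (Suc t) = delta P (allregs P) x (ideal P x 0 t) (if t = 0 then Some MC else None)"
| "ideal P x (Suc d) (Suc t) = delta P (allregs P) x (ideal P x (Suc d) t) (send (allregs P) x (ideal P x d t))"

lemma arun_c_block:
  assumes "v = replicate p LA @ replicate q LC" "p < i" "i \<le> p + q"
  shows "t \<le> p + q - i \<Longrightarrow> arun P x v t i = (if t = 0 then LC else CI)"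
    and "arun P x v (Suc (p + q - i)) i = HC"
proof -
  have v: "v ! (j - 1) = LC" if "p < j" "j \<le> p + q" for j
    using that assms(1) by (auto simp: nth_append)
  have *: "arun P x v t j = (if t = 0 then LC else CI)" if "p < j" "j \<le> p + q" "t \<le> p + q - j" for j t
    using that
  proof (induction t arbitrary: j)
    case 0
    then show ?case using v by simp
  next
    case (Suc t)
    then have "arun P x v t j = (if t = 0 then LC else CI)"
      "arun P x v t (Suc j) = (if t = 0 then LC else CI)" by auto
    moreover have "j < p + q" using Suc.prems by simp
    ultimately show ?case using assms(1) by simp
  qed
  then show "t \<le> p + q - i \<Longrightarrow> arun P x v t i = (if t = 0 then LC else CI)"
    using assms by blast
  show "arun P x v (Suc (p + q - i)) i = HC"
    using assms(2,3)
  proof (induction "p + q - i" arbitrary: i)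
    case 0
    then show ?case using v[of i] assms(1) by simp
  next
    case (Suc k)
    then have "k = p + q - Suc i" "p < Suc i" "Suc i \<le> p + q" by auto
    then have "arun P x v (Suc k) (Suc i) = HC" using Suc.hyps(1)[of "Suc i"] by (simp del: arun.simps)
    moreover have "arun P x v (Suc k) i = CI" using *[of i "Suc k"] Suc by simp
    ultimately show ?case using Suc.prems assms(1) Suc(2)[symmetric] by simp
  qed
qed

text \<open>The signal takes effect in cell \<open>p - d\<close> at time \<open>q + d + 1\<close>.
  Before that, nothing but the initial \<open>MC\<close> has entered the left block, so the cell
  follows its ideal run.\<close>

lemma arun_ideal:
  assumes "v = replicate p LA @ replicate q LC" "d < p" "1 \<le> q" "t \<le> q + d"
  shows "arun P x v t (p - d) = ideal P x d t"
  using assms(2,4)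
proof (induction t arbitrary: d)
  case 0
  then show ?case using assms(1) by (simp add: nth_append)
next
  case (Suc t)
  have IH: "arun P x v t (p - d) = ideal P x d t" using Suc by simp
  show ?case
  proof (cases d)
    case 0
    then have "arun P x v t (Suc p) = (if t = 0 then LC else CI)"
      using arun_c_block(1)[OF assms(1), of "Suc p" t] Suc.prems assms(3) by auto
    then show ?thesis using IH 0 assms(1,3) by simp
  next
    case (Suc d')
    then have "Suc (p - d) = p - d'" using Suc.prems by simp
    moreover have "arun P x v t (p - d') = ideal P x d' t" using Suc Suc.prems Suc.IH by simp
    moreover have "p - d < length v" using assms(1) Suc Suc.prems by simp
    ultimately show ?thesis using IH Suc by simp
  qed
qed

section \<open>Simulation of the counter machine\<close>

definition pc_at :: "instr list \<Rightarrow> nat \<Rightarrow> nat \<Rightarrow> nat" where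
  "pc_at P x d = fst ((step P ^^ d) (init x))"

definition counter_at :: "instr list \<Rightarrow> nat \<Rightarrow> nat \<Rightarrow> nat \<Rightarrow> nat" where
  "counter_at P x d = snd ((step P ^^ d) (init x))"

definition zeros :: "instr list \<Rightarrow> nat \<Rightarrow> nat \<Rightarrow> nat set" where
  "zeros P x d = {k \<in> allregs P. counter_at P x d k = 0}"

definition delayed :: "instr list \<Rightarrow> nat \<Rightarrow> nat \<Rightarrow> bool" where
  "delayed P x d \<longleftrightarrow> snd (snd (action P (allregs P) (pc_at P x d) (zeros P x d)))"

definition slow :: "instr list \<Rightarrow> nat \<Rightarrow> nat \<Rightarrow> nat set" where
  "slow P x d = fst (snd (action P (allregs P) (pc_at P x d) (zeros P x d)))"

text \<open>The border cell sends the program counter at time 1; each further cell costs one step,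
  or two if it delays it.\<close>

primrec sent_at :: "instr list \<Rightarrow> nat \<Rightarrow> nat \<Rightarrow> nat" where
  "sent_at P x 0 = 1"
| "sent_at P x (Suc d) = sent_at P x d + 1 + (if delayed P x d then 1 else 0)"

lemma sent_at_bounds: "1 \<le> sent_at P x d" "sent_at P x d \<le> 2 * d + 1"
  by (induction d) auto

text \<open>A counter is the gap between its marker and the program counter: delaying the marker
  widens it, delaying the program counter narrows it. The balance is additive to avoid truncated
  subtraction.\<close>

lemma action_step:
  assumes "pc_at P x d < length P"
  shows "fst (action P (allregs P) (pc_at P x d) (zeros P x d)) = pc_at P x (Suc d)"
    and "k \<in> allregs P \<Longrightarrow> counter_at P x (Suc d) k + (if delayed P x d then 1 else 0)
      = counter_at P x d k + (if k \<in> slow P x d then 1 else 0)"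
proof -
  obtain pc \<sigma> where s: "(step P ^^ d) (init x) = (pc, \<sigma>)" by fastforce
  have pc: "pc < length P" using assms s by (simp add: pc_at_def)
  have reg: "regs (P ! pc) \<subseteq> allregs P" using pc nth_mem unfolding allregs_def by blast
  note defs = pc_at_def counter_at_def zeros_def delayed_def slow_def action_def s
  show "fst (action P (allregs P) (pc_at P x d) (zeros P x d)) = pc_at P x (Suc d)"
    using pc reg by (cases "P ! pc") (auto simp: defs)
  show "k \<in> allregs P \<Longrightarrow> counter_at P x (Suc d) k + (if delayed P x d then 1 else 0)
      = counter_at P x d k + (if k \<in> slow P x d then 1 else 0)"
    using pc reg by (cases "P ! pc") (auto simp: defs)
qed

lemma start_running:
  assumes "pc_at P x d < length P"
  shows "start P (allregs P) (pc_at P x d) (zeros P x d) = Wk (slow P x d)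
    (if delayed P x d then None else Some (pc_at P x (Suc d))) (zeros P x d - slow P x d)
    (if delayed P x d then Some (pc_at P x (Suc d)) else None) (zeros P x d \<inter> slow P x d)
    (allregs P - zeros P x d)"
proof -
  have "action P (allregs P) (pc_at P x d) (zeros P x d) = (pc_at P x (Suc d), slow P x d, delayed P x d)"
    using action_step(1)[OF assms] by (simp add: slow_def delayed_def prod_eq_iff)
  then show ?thesis using assms by (simp add: start_def)
qed

lemma message_None [simp]: "message None {} = None"
  by (simp add: message_def)

lemma delta_Wk_message:
  "delta P K x (Wk D po ms pp pm un) (message None Y)
     = Wk D pp (pm \<union> (Y \<inter> un - D)) None (Y \<inter> un \<inter> D) (un - Y)"
  by (cases "Y = {}") (auto simp: message_def)

lemma delta_HD_message: "delta P K x HD (message po Y) = HD"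
  by (auto simp: message_def)

text \<open>Cell \<open>d\<close> correctly transmits the configuration after \<open>d\<close> steps.\<close>
definition emits :: "instr list \<Rightarrow> nat \<Rightarrow> nat \<Rightarrow> bool" where
  "emits P x d \<longleftrightarrow> (\<forall>t. send (allregs P) x (ideal P x d t) =
     message (if t = sent_at P x d then Some (pc_at P x d) else None)
       {k \<in> allregs P. sent_at P x d + counter_at P x d k = t})"

lemma ideal_0: "ideal P x 0 t =
  (if t = 0 then LA else if t = 1 then B0 else if t \<le> x + 2 then Ch (t - 2) else idle)"
proof (induction t)
  case (Suc t)
  then show ?case
    by (cases t) (auto simp: idle_def Suc_diff_le, (metis Suc_leI diff_Suc_Suc less_Suc_eq_le)?)
qed simp

lemma emits_0: "emits P x 0"
  unfolding emits_def
proof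
  fix t
  have 0: "0 \<in> allregs P" by (simp add: allregs_def)
  have counter_at: "counter_at P x 0 k = (if k = 0 then Suc x else 0)" and pc_at: "pc_at P x 0 = 0" for k
    by (simp_all add: counter_at_def pc_at_def init_def)
  consider "t = 0" | "t = 1" | "1 < t" "t < x + 2" | "t = x + 2" | "x + 2 < t" by linarith
  then show "send (allregs P) x (ideal P x 0 t) =
     message (if t = sent_at P x 0 then Some (pc_at P x 0) else None)
       {k \<in> allregs P. sent_at P x 0 + counter_at P x 0 k = t}"
  proof cases
    case 1
    then show ?thesis by (simp add: ideal_0)
  next
    case 2
    moreover have "{k \<in> allregs P. k \<noteq> 0} = allregs P - {0}" by auto
    ultimately show ?thesis by (auto simp: ideal_0 pc_at counter_at message_def)
  next
    case 3
    then have none: "{k \<in> allregs P. sent_at P x 0 + counter_at P x 0 k = t} = {}" by (auto simp: counter_at)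
    show ?thesis unfolding none using 3 by (auto simp: ideal_0)
  next
    case 4
    then have "{k \<in> allregs P. sent_at P x 0 + counter_at P x 0 k = t} = {0}" using 0 by (auto simp: counter_at)
    then show ?thesis using 4 by (auto simp: ideal_0 message_def)
  next
    case 5
    then have none: "{k \<in> allregs P. sent_at P x 0 + counter_at P x 0 k = t} = {}" by (auto simp: counter_at)
    show ?thesis unfolding none using 5 by (auto simp: ideal_0 idle_def)
  qed
qed

text \<open>No marker is ahead of the program counter, so the next cell hears nothing before
  it.\<close>

lemma ideal_waiting:
  assumes "emits P x d" "t \<le> sent_at P x d"
  shows "ideal P x (Suc d) t = (if t = 0 then LA else W)"
  using assms(2)
proof (induction t)
  case (Suc t)
  then have "send (allregs P) x (ideal P x d t) = None"
    using assms(1) by (simp add: emits_def)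
  then show ?case using Suc by simp
qed simp

lemma ideal_start:
  assumes "emits P x d"
  shows "ideal P x (Suc d) (Suc (sent_at P x d)) = start P (allregs P) (pc_at P x d) (zeros P x d)"
proof -
  have "ideal P x (Suc d) (sent_at P x d) = W"
    using ideal_waiting[OF assms order_refl] sent_at_bounds(1)[of P x d] by simp
  moreover have "send (allregs P) x (ideal P x d (sent_at P x d)) = Some (Cf (Some (pc_at P x d)) (zeros P x d))"
    using assms unfolding emits_def by (auto simp: message_def zeros_def)
  moreover have "zeros P x d \<inter> allregs P = zeros P x d" by (auto simp: zeros_def)
  ultimately show ?thesis by simp
qed

text \<open>Here \<open>s\<close> is the time since the cell received the program counter. A marker
  arrives when \<open>s\<close> equals its counter and leaves at once or, if slow, one step later,
  which yields the three sets.\<close>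

lemma ideal_running:
  assumes "emits P x d" "pc_at P x d < length P"
  defines "t \<equiv> \<lambda>s. Suc (sent_at P x d) + s"
  shows "ideal P x (Suc d) (t s) = Wk (slow P x d)
    (if t s = sent_at P x (Suc d) then Some (pc_at P x (Suc d)) else None)
    {k \<in> allregs P. counter_at P x d k + (if k \<in> slow P x d then 1 else 0) = s}
    (if Suc (t s) = sent_at P x (Suc d) then Some (pc_at P x (Suc d)) else None)
    {k \<in> allregs P. k \<in> slow P x d \<and> counter_at P x d k = s}
    {k \<in> allregs P. s < counter_at P x d k}"
proof (induction s)
  case 0
  have "zeros P x d - slow P x d = {k \<in> allregs P. counter_at P x d k + (if k \<in> slow P x d then 1 else 0) = 0}"
    "zeros P x d \<inter> slow P x d = {k \<in> allregs P. k \<in> slow P x d \<and> counter_at P x d k = 0}"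
    "allregs P - zeros P x d = {k \<in> allregs P. 0 < counter_at P x d k}"
    by (auto simp: zeros_def)
  then show ?case
    using ideal_start[OF assms(1)] unfolding start_running[OF assms(2)] t_def
    by (simp del: ideal.simps)
next
  case (Suc s)
  let ?Y = "{k \<in> allregs P. counter_at P x d k = Suc s}" and ?un = "{k \<in> allregs P. s < counter_at P x d k}"
    and ?D = "slow P x d"
  have "{k \<in> allregs P. sent_at P x d + counter_at P x d k = t s} = ?Y" by (auto simp: t_def)
  then have snd: "send (allregs P) x (ideal P x d (t s)) = message None ?Y"
    using assms(1) unfolding emits_def by (simp add: t_def)
  have tS: "t (Suc s) = Suc (t s)" by (simp add: t_def)
  \<comment> \<open>The program counter is delayed by at most one step, so nothing of it is pending
    after relative time 0.\<close>
  have pp: "Suc (Suc (t s)) \<noteq> sent_at P x (Suc d)" by (simp add: t_def)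
  have sets: "{k \<in> allregs P. k \<in> ?D \<and> counter_at P x d k = s} \<union> (?Y \<inter> ?un - ?D)
      = {k \<in> allregs P. counter_at P x d k + (if k \<in> ?D then 1 else 0) = Suc s}"
    "?Y \<inter> ?un \<inter> ?D = {k \<in> allregs P. k \<in> ?D \<and> counter_at P x d k = Suc s}"
    "?un - ?Y = {k \<in> allregs P. Suc s < counter_at P x d k}"
    by auto
  show ?case
    unfolding tS ideal.simps Suc.IH snd delta_Wk_message sets using pp by simp
qed

text \<open>By the balance in \<open>action_step\<close>, the time at which a marker leaves,
  computed from the old counter and its delay, is the new \<open>sent_at\<close> plus the new
  counter.\<close>

lemma emits_Suc:
  assumes "emits P x d" "pc_at P x d < length P"
  shows "emits P x (Suc d)"
  unfolding emits_def
proof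
  fix t
  show "send (allregs P) x (ideal P x (Suc d) t) =
     message (if t = sent_at P x (Suc d) then Some (pc_at P x (Suc d)) else None)
       {k \<in> allregs P. sent_at P x (Suc d) + counter_at P x (Suc d) k = t}"
  proof (cases "t \<le> sent_at P x d")
    case True
    then have "{k \<in> allregs P. sent_at P x (Suc d) + counter_at P x (Suc d) k = t} = {}" by auto
    then show ?thesis
      using ideal_waiting[OF assms(1) True] True by (simp del: ideal.simps)
  next
    case False
    then obtain s where t: "t = Suc (sent_at P x d) + s" by (metis less_iff_Suc_add not_le add_Suc)
    have "{k \<in> allregs P. counter_at P x d k + (if k \<in> slow P x d then 1 else 0) = s}
      = {k \<in> allregs P. sent_at P x (Suc d) + counter_at P x (Suc d) k = t}"
      using action_step(2)[OF assms(2)] unfolding t by (auto split: if_splits; fastforce)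
    then show ?thesis
      unfolding t ideal_running[OF assms] by simp
  qed
qed

lemma ideal_halted:
  assumes "emits P x d" "length P \<le> pc_at P x d"
  shows "ideal P x (Suc d) (Suc (sent_at P x d) + s) = HD"
proof (induction s)
  case 0
  then show ?case using ideal_start[OF assms(1)] assms(2) by (simp add: start_def del: ideal.simps)
next
  case (Suc s)
  have "Suc (sent_at P x d) + Suc s = Suc (Suc (sent_at P x d) + s)" by simp
  then show ?case
    using Suc assms(1) unfolding emits_def by (simp only: ideal.simps delta_HD_message)
qed

lemma emits: "(\<And>j. j < d \<Longrightarrow> pc_at P x j < length P) \<Longrightarrow> emits P x d"
  by (induction d) (auto intro: emits_0 emits_Suc)

lemma ideal_not_halted:
  assumes "\<not> halts P x"
  shows "ideal P x d t \<noteq> HD"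
proof (cases d)
  case 0
  then show ?thesis by (simp add: ideal_0 idle_def)
next
  case (Suc d')
  have run: "pc_at P x j < length P" for j
    using assms by (auto simp: halts_def pc_at_def not_le)
  show ?thesis
  proof (cases "t \<le> sent_at P x d'")
    case True
    then show ?thesis using ideal_waiting[OF emits[OF run]] Suc by simp
  next
    case False
    then obtain s where "t = Suc (sent_at P x d') + s" by (metis less_iff_Suc_add not_le add_Suc)
    then show ?thesis using ideal_running[OF emits[OF run] run] Suc by simp
  qed
qed

text \<open>Acceptance needs \<open>HD\<close> in the leftmost cell just before the signal. At that
  moment the cell still follows its ideal run, where \<open>HD\<close> occurs only if the machine
  halts.\<close>

lemma arun_Acc:
  assumes "set v \<subseteq> {LA, LC}" "v \<noteq> []" "arun P x v t 1 = Acc"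
  shows "t = length v \<and> halts P x \<and> (\<exists>p q. v = replicate p LA @ replicate q LC)"
proof -
  have len: "1 \<le> length v" using assms(2) by (cases v) auto
  from arun_HC_Acc[OF assms(1) order_refl len, of P x t] assms(3) obtain p q where
    t: "t = length v" and v: "v = replicate p LA @ replicate (Suc q) LC" by auto
  have t': "t = Suc (p + q)" using t v by simp
  have "p \<noteq> 0"
  proof
    assume "p = 0"
    then have "v ! (1 - 1) = LC" using v by simp
    from arun_LC[OF assms(1) order_refl len this, of t P x] t len assms(3) show False by auto
  qed
  moreover have "arun P x v (p + q) 1 = HD"
    using assms(3) unfolding t' by (auto dest: delta_Acc)
  ultimately have "ideal P x (p - 1) (p + q) = HD"
    using arun_ideal[OF v, of "p - 1" "p + q" P x] by auto
  then show ?thesis using ideal_not_halted t v by blast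
qed

lemma arun_accepting:
  assumes "halts P x"
  shows "\<exists>v. set v \<subseteq> {LA, LC} \<and> v \<noteq> [] \<and> (\<exists>t \<ge> 1. arun P x v t 1 = Acc)"
proof -
  define m where "m = (LEAST m. length P \<le> pc_at P x m)"
  have m: "length P \<le> pc_at P x m" and run: "\<And>j. j < m \<Longrightarrow> pc_at P x j < length P"
    using assms LeastI_ex[of "\<lambda>m. length P \<le> pc_at P x m"] not_less_Least
    unfolding m_def halts_def pc_at_def[symmetric] by (auto simp: not_le[symmetric])
  have em: "emits P x d" if "d \<le> m" for d using that run by (intro emits) auto
  \<comment> \<open>The border cell, one cell for each of the \<open>m\<close> machine steps, and
    the leftmost cell, which enters \<open>HD\<close>.\<close>
  define p where "p = m + 2"
  \<comment> \<open>Large enough that the border cell is past its chain, as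
    \<open>x + 2 < q\<close>, and that every program counter, sent by time \<open>2 * d + 1\<close>,
    stays ahead of the signal.\<close>
  define q where "q = 2 * m + x + 10"
  define v where "v = replicate p LA @ replicate q LC"
  have late: "\<exists>s. q + Suc d = Suc (sent_at P x d) + s" if "d \<le> m" for d
  proof -
    have "Suc (sent_at P x d) \<le> q + Suc d" using sent_at_bounds(2)[of P x d] that by (simp add: q_def)
    then show ?thesis using le_Suc_ex by blast
  qed
  have working: "\<exists>D po ms pp pm un. ideal P x d (q + d) = Wk D po ms pp pm un" if d: "d \<le> m" for d
  proof (cases d)
    case 0
    then show ?thesis by (simp add: ideal_0 q_def idle_def)
  next
    case (Suc d')
    then obtain s where s: "q + d = Suc (sent_at P x d') + s" using late[of d'] d by auto
    from Suc d have "d' \<le> m" "d' < m" by auto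
    from ideal_running[OF em[OF this(1)] run[OF this(2)], of s]
    show ?thesis unfolding s unfolding Suc by (simp del: ideal.simps)
  qed
  have signal: "arun P x v (Suc (q + d)) (p - d) = delta P (allregs P) x (ideal P x d (q + d)) (Some MH)"
    if "d = 0 \<or> arun P x v (q + d) (Suc (p - d)) = HC" "d \<le> Suc m" for d
  proof -
    have "Suc (p + q - Suc p) = q" by (simp add: q_def)
    then have "arun P x v q (Suc p) = HC"
      using arun_c_block(2)[OF v_def, of "Suc p" P x] by (simp del: arun.simps)
    then have "arun P x v (q + d) (Suc (p - d)) = HC" using that by auto
    moreover have "arun P x v (q + d) (p - d) = ideal P x d (q + d)"
      using that by (intro arun_ideal[OF v_def]) (auto simp: p_def q_def)
    moreover have "p - d < length v" by (simp add: v_def p_def q_def)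
    ultimately show ?thesis by simp
  qed
  have HC: "arun P x v (Suc (q + d)) (p - d) = HC" if "d \<le> m" for d
    using that
  proof (induction d)
    case 0
    then show ?case using signal[of 0] working[of 0] by (auto simp del: arun.simps)
  next
    case (Suc d)
    moreover have "Suc (p - Suc d) = p - d" using Suc.prems by (simp add: p_def)
    ultimately show ?case
      using signal[of "Suc d"] working[of "Suc d"] by (auto simp del: arun.simps)
  qed
  have "ideal P x (Suc m) (q + Suc m) = HD"
    using late[of m] ideal_halted[OF em m] by auto
  moreover have "p - Suc m = 1" "Suc (p - Suc m) = p - m" by (simp_all add: p_def)
  ultimately have "arun P x v (Suc (q + Suc m)) 1 = Acc"
    using signal[of "Suc m"] HC[of m] by (simp del: arun.simps ideal.simps)
  moreover have "set v \<subseteq> {LA, LC}" "v \<noteq> []" by (auto simp: v_def p_def)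
  moreover have "1 \<le> Suc (q + Suc m)" by simp
  ultimately show ?thesis by blast
qed

section \<open>Numerical encoding of the automaton\<close>

definition index_of :: "'a list \<Rightarrow> 'a \<Rightarrow> nat" where
  "index_of xs s = length (takeWhile (\<lambda>y. y \<noteq> s) xs)"

lemma index_of: assumes "s \<in> set xs" shows "index_of xs s < length xs" "xs ! index_of xs s = s"
proof -
  show "index_of xs s < length xs" using assms by (induction xs) (auto simp: index_of_def)
  then show "xs ! index_of xs s = s" using nth_length_takeWhile[of "\<lambda>y. y \<noteq> s" xs] by (simp add: index_of_def)
qed

definition state_list :: "instr list \<Rightarrow> st list" where
  "state_list P = (SOME xs. set xs = base_states P)"

definition msg_list :: "instr list \<Rightarrow> msg list" where
  "msg_list P = (SOME xs. set xs = msgs P)"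

lemma set_state_list [simp]: "set (state_list P) = base_states P"
  unfolding state_list_def by (rule someI_ex[OF finite_list[OF finite_base_states]])

lemma set_msg_list [simp]: "set (msg_list P) = msgs P"
  unfolding msg_list_def by (rule someI_ex[OF finite_list[OF finite_msgs]])

text \<open>Chain states are numbered after all base states, so enlarging \<open>x\<close> appends
  states without renumbering.\<close>

definition enc :: "instr list \<Rightarrow> st \<Rightarrow> nat" where
  "enc P s = (case s of Ch j \<Rightarrow> length (state_list P) + j | _ \<Rightarrow> index_of (state_list P) s)"

definition dec :: "instr list \<Rightarrow> nat \<Rightarrow> st" where
  "dec P i = (if i < length (state_list P) then state_list P ! i else Ch (i - length (state_list P)))"

lemma enc_Ch: "enc P (Ch j) = length (state_list P) + j"
  by (simp add: enc_def)

lemma enc_base: "s \<in> base_states P \<Longrightarrow> enc P s = index_of (state_list P) s"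
  by (cases s) (auto simp: enc_def Ch_base)

lemma dec_enc: "s \<in> states P x \<Longrightarrow> dec P (enc P s) = s"
  by (auto simp: enc_base enc_Ch dec_def index_of)

lemma enc_less: "s \<in> states P x \<Longrightarrow> enc P s < length (state_list P) + Suc x"
  using index_of(1)[of s "state_list P"] by (auto simp: enc_base enc_Ch)

definition num :: "instr list \<Rightarrow> msg option \<Rightarrow> nat" where
  "num P y = (case y of None \<Rightarrow> 0 | Some m \<Rightarrow> Suc (index_of (msg_list P) m))"

text \<open>The order is that of \<open>sym_idx\<close>: bottom, boundary symbol, messages. The
  boundary symbol acts as \<open>MH\<close>.\<close>

definition syms :: "instr list \<Rightarrow> msg option list" where
  "syms P = None # Some MH # map Some (msg_list P)"

definition row :: "instr list \<Rightarrow> st \<Rightarrow> nat list" where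
  "row P s = map (\<lambda>y. enc P (delta P (allregs P) 0 s y)) (syms P)"

text \<open>The rows after those of \<open>state_list\<close> belong to the chain:
  \<open>Ch j\<close> with \<open>j < x\<close> moves on silently, \<open>Ch x\<close> sends the
  marker of counter 0 and becomes \<open>idle\<close>.\<close>

definition cell_oca :: "instr list \<Rightarrow> nat \<Rightarrow> oca" where
  "cell_oca P x = OCA (length (state_list P) + Suc x) [enc P Acc] [enc P LA, enc P LC] (length (msg_list P))
     (map (\<lambda>s. num P (send (allregs P) 0 s)) (state_list P) @ replicate x 0 @ [num P (Some (Cf None {0}))])
     (map (row P) (state_list P)
       @ map (\<lambda>j. replicate (length (syms P)) (length (state_list P) + Suc j)) [0..<x]
       @ [replicate (length (syms P)) (enc P idle)])"

lemma base_simps [simp]: "LA \<in> base_states P" "LC \<in> base_states P" "Acc \<in> base_states P"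
  by (simp_all add: base_states_def)

lemma send_base: "s \<in> base_states P \<Longrightarrow> send K x s = send K 0 s"
  by (cases s) (auto simp: Ch_base)

lemma bl_cell_oca:
  assumes "s \<in> states P x"
  shows "bl (cell_oca P x) ! enc P s = num P (send (allregs P) x s)"
proof (cases "s \<in> base_states P")
  case True
  then show ?thesis using index_of[of s "state_list P"] send_base[OF True, of _ x]
    by (simp add: cell_oca_def enc_base nth_append)
next
  case False
  then show ?thesis using assms
    by (auto simp: cell_oca_def enc_Ch nth_append num_def)
qed

definition symof :: "instr list \<Rightarrow> msg option \<Rightarrow> sym" where
  "symof P y = (case y of None \<Rightarrow> Bot | Some m \<Rightarrow> Msg (index_of (msg_list P) m))"

lemma blf_cell_oca:
  "s \<in> states P x \<Longrightarrow> blf (cell_oca P x) (enc P s) = symof P (send (allregs P) x s)"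
  unfolding blf_def by (simp add: bl_cell_oca num_def symof_def split: option.split)

lemma dl_cell_oca:
  assumes "s \<in> states P x" "i < length (syms P)"
  shows "dl (cell_oca P x) ! enc P s ! i = enc P (delta P (allregs P) x s (syms P ! i))"
proof (cases "s \<in> base_states P")
  case True
  then show ?thesis using index_of[of s "state_list P"] delta_base[OF True, of _ x] assms(2)
    by (simp add: cell_oca_def enc_base nth_append row_def)
next
  case False
  then obtain j where s: "s = Ch j" "j \<le> x" using assms(1) by auto
  show ?thesis
  proof (cases "j < x")
    case True
    then have "dl (cell_oca P x) ! enc P s = replicate (length (syms P)) (length (state_list P) + Suc j)"
      by (simp add: cell_oca_def enc_Ch s nth_append)
    then show ?thesis using assms(2) s True by (simp add: enc_Ch)
  next
    case False
    then have "dl (cell_oca P x) ! enc P s = replicate (length (syms P)) (enc P idle)"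
      using s(2) by (simp add: cell_oca_def enc_Ch s nth_append)
    then show ?thesis using assms(2) s False by simp
  qed
qed

lemma dlt_symof:
  assumes "s \<in> states P x" "y = None \<or> y \<in> Some ` msgs P"
  shows "dlt (cell_oca P x) (enc P s) (symof P y) = enc P (delta P (allregs P) x s y)"
proof -
  have "sym_idx (symof P y) < length (syms P)" "syms P ! sym_idx (symof P y) = y"
    using assms(2) index_of[of _ "msg_list P"] by (auto simp: symof_def sym_idx_def syms_def)
  then show ?thesis unfolding dlt_def using dl_cell_oca[OF assms(1)] by simp
qed

lemma dlt_Hash:
  assumes "s \<in> states P x"
  shows "dlt (cell_oca P x) (enc P s) Hash = enc P (delta P (allregs P) x s (Some MH))"
  unfolding dlt_def using dl_cell_oca[OF assms, of 1] by (simp add: sym_idx_def syms_def)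

lemma cfg_cell_oca:
  assumes "set v \<subseteq> {LA, LC}" "1 \<le> i" "i \<le> length v"
  shows "cfg (cell_oca P x) (map (enc P) v) t i = enc P (arun P x v t i)"
  using assms(2-)
proof (induction t arbitrary: i)
  case 0
  then show ?case by simp
next
  case (Suc t)
  have st: "arun P x v t j \<in> states P x" if "1 \<le> j" "j \<le> length v" for j
    using arun_states[OF assms(1) that] .
  have None: "symof P None = Bot" by (simp add: symof_def)
  show ?case
  proof (cases "i < length v")
    case True
    let ?y = "send (allregs P) x (arun P x v t (Suc i))"
    have "?y = None \<or> ?y \<in> Some ` msgs P"
      using send_msgs[OF st[of "Suc i"]] True by (cases ?y) auto
    then show ?thesis
      using True Suc st by (simp add: blf_cell_oca dlt_symof)
  next
    case False
    then show ?thesis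
      using Suc.IH[OF Suc.prems] dlt_symof[OF st[OF Suc.prems], of None] dlt_Hash[OF st[OF Suc.prems]]
      unfolding cfg.simps(2) arun.simps(2) None by (cases "t = 0") (simp_all del: arun.simps cfg.simps One_nat_def)
  qed
qed

section \<open>Language and communication of the automaton\<close>

lemma lang_cell_oca:
  "w \<in> lang (cell_oca P x) \<longleftrightarrow> (\<exists>v. w = map (enc P) v \<and> set v \<subseteq> {LA, LC} \<and> v \<noteq> [] \<and>
     (\<exists>t \<ge> 1. arun P x v t 1 = Acc))"
proof -
  have *: "cfg (cell_oca P x) (map (enc P) v) t 1 \<in> set (fin (cell_oca P x)) \<longleftrightarrow> arun P x v t 1 = Acc"
    if v: "set v \<subseteq> {LA, LC}" "v \<noteq> []" for v t
  proof -
    have len: "1 \<le> length v" using v(2) by (cases v) auto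
    have "cfg (cell_oca P x) (map (enc P) v) t 1 = enc P (arun P x v t 1)"
      by (rule cfg_cell_oca[OF v(1) order_refl len])
    moreover have "arun P x v t 1 \<in> states P x" by (rule arun_states[OF v(1) order_refl len])
    moreover have "Acc \<in> states P x" by simp
    ultimately have "cfg (cell_oca P x) (map (enc P) v) t 1 = enc P Acc \<longleftrightarrow> arun P x v t 1 = Acc"
      using dec_enc by metis
    then show ?thesis by (simp add: cell_oca_def)
  qed
  have fin_inp: "set w \<subseteq> set (inp (cell_oca P x)) \<longleftrightarrow> (\<exists>v. w = map (enc P) v \<and> set v \<subseteq> {LA, LC})"
  proof
    assume "set w \<subseteq> set (inp (cell_oca P x))"
    then have "w \<in> lists (enc P ` {LA, LC})" by (auto simp: cell_oca_def in_lists_conv_set)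
    then show "\<exists>v. w = map (enc P) v \<and> set v \<subseteq> {LA, LC}"
      unfolding lists_image by (auto simp: in_lists_conv_set)
  qed (auto simp: cell_oca_def)
  show ?thesis
  proof
    assume "w \<in> lang (cell_oca P x)"
    then obtain v t where "w = map (enc P) v" "set v \<subseteq> {LA, LC}" "w \<noteq> []" "t \<ge> 1"
      "cfg (cell_oca P x) w t 1 \<in> set (fin (cell_oca P x))"
      unfolding lang_def accepts_def mem_Collect_eq fin_inp by blast
    moreover from this have "v \<noteq> []" by auto
    ultimately show "\<exists>v. w = map (enc P) v \<and> set v \<subseteq> {LA, LC} \<and> v \<noteq> [] \<and>
      (\<exists>t \<ge> 1. arun P x v t 1 = Acc)" using * by blast
  next
    assume "\<exists>v. w = map (enc P) v \<and> set v \<subseteq> {LA, LC} \<and> v \<noteq> [] \<and> (\<exists>t \<ge> 1. arun P x v t 1 = Acc)"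
    then show "w \<in> lang (cell_oca P x)"
      unfolding lang_def accepts_def mem_Collect_eq fin_inp using * by blast
  qed
qed

lemma length_syms: "length (syms P) = length (msg_list P) + 2"
  by (simp add: syms_def)

lemma idle_base: "idle \<in> base_states P"
  by (simp add: idle_def Wk_base opts_def)

lemma num_le: "y = None \<or> y \<in> Some ` msgs P \<Longrightarrow> num P y \<le> length (msg_list P)"
  using index_of(1)[of _ "msg_list P"] by (auto simp: num_def Suc_le_eq)

lemma wf_cell_oca: "wf_oca (cell_oca P x)"
proof -
  have enc: "enc P s < Suc (length (state_list P) + x)" if "s \<in> base_states P" for s
    using enc_less[of s P x] that by simp
  have "send (allregs P) 0 s = None \<or> send (allregs P) 0 s \<in> Some ` msgs P" if "s \<in> base_states P" for s
    using that send_msgs[of s P 0] by (cases "send (allregs P) 0 s") auto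
  moreover have "Cf None {0} \<in> msgs P" by (auto simp: msgs_def opts_def allregs_def)
  ultimately have bl: "\<forall>b \<in> set (bl (cell_oca P x)). b \<le> ncom (cell_oca P x)"
    by (auto simp: cell_oca_def intro!: num_le)
  have "enc P (delta P (allregs P) 0 s y) < Suc (length (state_list P) + x)" if "s \<in> base_states P" for s y
    using delta_states[of s P 0 y] enc_less[of "delta P (allregs P) 0 s y" P 0] that by simp
  with enc have dl: "\<forall>r \<in> set (dl (cell_oca P x)). length r = ncom (cell_oca P x) + 2 \<and>
      (\<forall>i \<in> set r. i < nst (cell_oca P x))"
    using enc idle_base by (auto simp: cell_oca_def row_def length_syms)
  have "length (bl (cell_oca P x)) = nst (cell_oca P x)" "length (dl (cell_oca P x)) = nst (cell_oca P x)"
    by (simp_all add: cell_oca_def)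
  with bl dl have "\<forall>s < nst (cell_oca P x). bl (cell_oca P x) ! s \<le> ncom (cell_oca P x)"
    "\<forall>s < nst (cell_oca P x). length (dl (cell_oca P x) ! s) = ncom (cell_oca P x) + 2 \<and>
      (\<forall>i \<in> set (dl (cell_oca P x) ! s). i < nst (cell_oca P x))"
    using nth_mem by metis+
  moreover have "set (fin (cell_oca P x)) \<subseteq> {0..<nst (cell_oca P x)}"
    "set (inp (cell_oca P x)) \<subseteq> {0..<nst (cell_oca P x)}"
    by (auto simp: cell_oca_def intro!: enc)
  ultimately show ?thesis
    using \<open>length (bl _) = _\<close> \<open>length (dl _) = _\<close> unfolding wf_oca_def by blast
qed

lemma real_time_cell_oca: "real_time (cell_oca P x)"
  unfolding real_time_def
proof
  fix w assume "w \<in> lang (cell_oca P x)"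
  then obtain v t where v: "w = map (enc P) v" "set v \<subseteq> {LA, LC}" "v \<noteq> []" "t \<ge> 1" "arun P x v t 1 = Acc"
    unfolding lang_cell_oca by blast
  then have "t = length w" "1 \<le> length v" using arun_Acc by (auto simp: Suc_le_eq)
  moreover have "cfg (cell_oca P x) w t 1 = enc P Acc"
    using cfg_cell_oca[OF v(2) order_refl \<open>1 \<le> length v\<close>] v by metis
  ultimately show "\<exists>t. 1 \<le> t \<and> t \<le> length w \<and> cfg (cell_oca P x) w t 1 \<in> set (fin (cell_oca P x))"
    using v(4) by (auto simp: cell_oca_def)
qed

lemma com_cell_oca:
  assumes "w \<in> lang (cell_oca P x)" "1 \<le> i" "i \<le> length w - 1"
  shows "com (cell_oca P x) w i (length w) \<le> card (allregs P) + 4"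
proof -
  obtain v where v: "w = map (enc P) v" "set v \<subseteq> {LA, LC}"
    using assms(1) unfolding lang_cell_oca by blast
  have i: "1 \<le> Suc i" "Suc i \<le> length v" using assms v by auto
  have "blf (cell_oca P x) (cfg (cell_oca P x) w j (Suc i)) \<noteq> Bot
      \<longleftrightarrow> send (allregs P) x (arun P x v j (Suc i)) \<noteq> None" for j
    unfolding v(1) cfg_cell_oca[OF v(2) i] blf_cell_oca[OF arun_states[OF v(2) i]]
    by (simp add: symof_def split: option.split)
  then show ?thesis using arun_send_card[OF v(2) i] unfolding com_def by simp
qed

lemma sum_com_linear_cell_oca: "sum_com_linear (cell_oca P x)"
  unfolding sum_com_linear_def
proof (intro exI conjI ballI)
  let ?B = "card (allregs P) + 4"
  show "(\<lambda>n. real (?B * n)) \<in> O(\<lambda>n. real n)" by simp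
  fix w assume "w \<in> lang (cell_oca P x)"
  then have "scom (cell_oca P x) w \<le> (\<Sum>i = 1..length w - 1. ?B)"
    unfolding scom_def by (intro sum_mono com_cell_oca) auto
  also have "\<dots> \<le> ?B * length w" by simp
  finally show "scom (cell_oca P x) w \<le> ?B * length w" .
qed

lemma max_com_log_cell_oca: "max_com_log (cell_oca P x)"
  unfolding max_com_log_def
proof (intro exI conjI ballI)
  let ?B = "card (allregs P) + 4"
  \<comment> \<open>A constant lies in the class of the logarithm because \<open>ln\<close> is
    eventually at least 1.\<close>
  have "filterlim (\<lambda>n. ln (real n)) at_top sequentially"
    by (rule filterlim_compose[OF ln_at_top filterlim_real_sequentially])
  then have "eventually (\<lambda>n. 1 \<le> ln (real n)) sequentially"
    by (simp add: filterlim_at_top)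
  then show "(\<lambda>n. real ?B) \<in> O(\<lambda>n. ln (real n))"
    by (intro bigoI[where c = "real ?B"]) (auto elim!: eventually_mono)
  fix w assume "w \<in> lang (cell_oca P x)"
  then have "\<forall>c \<in> insert 0 {com (cell_oca P x) w i (length w) | i. 1 \<le> i \<and> i \<le> length w - 1}. c \<le> ?B"
    using com_cell_oca by auto
  moreover have "{com (cell_oca P x) w i (length w) | i. 1 \<le> i \<and> i \<le> length w - 1}
    = (\<lambda>i. com (cell_oca P x) w i (length w)) ` {1..length w - 1}" by auto
  then have "finite {com (cell_oca P x) w i (length w) | i. 1 \<le> i \<and> i \<le> length w - 1}" by simp
  ultimately show "mcom (cell_oca P x) w \<le> ?B"
    unfolding mcom_def by (subst Max_le_iff) simp_all
qed

lemma bounded_lang_cell_oca: "bounded_lang (inp (cell_oca P x)) (lang (cell_oca P x))"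
  unfolding bounded_lang_def
proof (intro exI conjI subsetI)
  have "enc P LA \<noteq> enc P LC" using dec_enc[of LA P x] dec_enc[of LC P x] by auto
  then show "distinct [enc P LA, enc P LC]" by simp
  show "set [enc P LA, enc P LC] = set (inp (cell_oca P x))" by (simp add: cell_oca_def)
  fix w assume "w \<in> lang (cell_oca P x)"
  then obtain v t where "w = map (enc P) v" "set v \<subseteq> {LA, LC}" "v \<noteq> []" "arun P x v t 1 = Acc"
    unfolding lang_cell_oca by blast
  moreover from this obtain p q where "v = replicate p LA @ replicate q LC" using arun_Acc by blast
  ultimately have "w = concat (map (\<lambda>(a, k). replicate k a) (zip [enc P LA, enc P LC] [p, q]))"
    by simp
  then show "w \<in> {concat (map (\<lambda>(a, k). replicate k a) (zip [enc P LA, enc P LC] ks)) | ks.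
      length ks = length [enc P LA, enc P LC]}"
    by (intro CollectI exI[of _ "[p, q]"]) simp
qed

lemma lang_cell_oca_empty_iff: "lang (cell_oca P x) = {} \<longleftrightarrow> \<not> halts P x"
proof
  assume "lang (cell_oca P x) = {}"
  then show "\<not> halts P x" using arun_accepting[of P x] lang_cell_oca[of _ P x] by blast
next
  assume "\<not> halts P x"
  then show "lang (cell_oca P x) = {}" using arun_Acc lang_cell_oca[of _ P x] by blast
qed

section \<open>Diagonalization\<close>

text \<open>The step function of a recursion sees the accumulator and the index in front of the
  parameters; this skips them.\<close>

lemma recfun_tl_tl:
  assumes "recfun n F" shows "recfun (Suc (Suc n)) (\<lambda>ys. F (tl (tl ys)))"
proof -
  let ?As = "map (\<lambda>i ys. ys ! Suc (Suc i)) [0..<n] :: (nat list \<Rightarrow> nat) list"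
  have "recfun (length ?As) F" using assms by simp
  moreover have "recfun (Suc (Suc n)) A" if "A \<in> set ?As" for A
    using that by (auto intro: recfun_proj)
  ultimately have "recfun (Suc (Suc n)) (\<lambda>ys. F (map (\<lambda>A. A ys) ?As))"
    by (rule recfun_comp[where As = ?As and G = F])
  moreover have "map (\<lambda>A. A ys) ?As = tl (tl ys)" if "length ys = Suc (Suc n)" for ys :: "nat list"
    using that by (intro nth_equalityI) (auto simp: nth_tl)
  ultimately show ?thesis by (elim recfun_cong) simp
qed

definition ndrop :: "nat \<Rightarrow> nat \<Rightarrow> nat" where
  "ndrop i l = rec_nat l (\<lambda>_ r. ntl r) i"

definition nreplicate :: "nat \<Rightarrow> nat \<Rightarrow> nat \<Rightarrow> nat" where
  "nreplicate k a v = rec_nat v (\<lambda>_ r. ncons a r) k"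

definition nrevapp :: "nat \<Rightarrow> nat \<Rightarrow> nat \<Rightarrow> nat" where
  "nrevapp k l v = rec_nat v (\<lambda>i r. ncons (nhd (ndrop i l)) r) k"

text \<open>The list grows at its front, so the chain rows are produced with descending targets
  \<open>c + (x - i)\<close>.\<close>

definition nchain :: "nat \<Rightarrow> nat \<Rightarrow> nat \<Rightarrow> nat \<Rightarrow> nat" where
  "nchain k c x v = rec_nat v (\<lambda>i r. ncons (nreplicate k (c + (x - i)) 0) r) x"

lemma recfun_ndrop:
  assumes "recfun n K" "recfun n L" shows "recfun n (\<lambda>xs. ndrop (K xs) (L xs))"
  unfolding ndrop_def
  using recfun_prec[OF assms(2) recfun_ntl[OF recfun_proj[of 0]] assms(1)] by simp

lemma recfun_nreplicate:
  assumes "recfun n K" "recfun n A" "recfun n V"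
  shows "recfun n (\<lambda>xs. nreplicate (K xs) (A xs) (V xs))"
  unfolding nreplicate_def
  using recfun_prec[OF assms(3) recfun_ncons[OF recfun_tl_tl[OF assms(2)] recfun_proj[of 0]] assms(1)]
  by simp

lemma recfun_nrevapp:
  assumes "recfun n K" "recfun n L" "recfun n V"
  shows "recfun n (\<lambda>xs. nrevapp (K xs) (L xs) (V xs))"
  unfolding nrevapp_def
  using recfun_prec[OF assms(3) recfun_ncons[OF
      recfun_nhd[OF recfun_ndrop[OF recfun_proj[of 1] recfun_tl_tl[OF assms(2)]]] recfun_proj[of 0]] assms(1)]
  by simp

lemma recfun_nchain:
  assumes "recfun n K" "recfun n C" "recfun n X" "recfun n V"
  shows "recfun n (\<lambda>xs. nchain (K xs) (C xs) (X xs) (V xs))"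
  unfolding nchain_def
  using recfun_prec[OF assms(4) recfun_ncons[OF recfun_nreplicate[OF recfun_tl_tl[OF assms(1)]
      recfun_add[OF recfun_tl_tl[OF assms(2)] recfun_diff[OF recfun_tl_tl[OF assms(3)] recfun_proj[of 1]]]
      recfun_zero] recfun_proj[of 0]] assms(3)]
  by simp

lemma ntl_list_encode_drop: "i < length xs \<Longrightarrow> ntl (list_encode (drop i xs)) = list_encode (drop (Suc i) xs)"
  and nhd_list_encode_drop: "i < length xs \<Longrightarrow> nhd (list_encode (drop i xs)) = xs ! i"
  by (simp_all add: list_encode_Cons del: list_encode.simps flip: Cons_nth_drop_Suc)

lemma ndrop: "i \<le> length xs \<Longrightarrow> ndrop i (list_encode xs) = list_encode (drop i xs)"
  by (induction i) (auto simp: ndrop_def ntl_list_encode_drop)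

lemma nreplicate: "nreplicate k a (list_encode xs) = list_encode (replicate k a @ xs)"
  by (induction k) (auto simp: nreplicate_def ncons_def)

lemma nrevapp:
  "nrevapp (length xs) (list_encode (rev xs)) (list_encode ys) = list_encode (xs @ ys)"
proof -
  have "k \<le> length xs \<Longrightarrow> nrevapp k (list_encode (rev xs)) (list_encode ys)
    = list_encode (drop (length xs - k) xs @ ys)" for k
  proof (induction k)
    case 0
    then show ?case by (simp add: nrevapp_def)
  next
    case (Suc k)
    let ?j = "length xs - Suc k"
    have "drop ?j xs = xs ! ?j # drop (length xs - k) xs"
      using Suc.prems Cons_nth_drop_Suc[of ?j xs] by (simp add: Suc_diff_Suc)
    moreover have "nhd (ndrop k (list_encode (rev xs))) = xs ! ?j"
      using Suc.prems by (simp add: ndrop nhd_list_encode_drop rev_nth)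
    ultimately show ?case
      using Suc by (simp add: nrevapp_def list_encode_Cons del: list_encode.simps(2))
  qed
  from this[of "length xs"] show ?thesis by simp
qed

lemma nchain:
  "nchain k c x (list_encode ys)
     = list_encode (map (\<lambda>j. list_encode (replicate k (c + Suc j))) [0..<x] @ ys)"
proof -
  let ?f = "\<lambda>j. list_encode (replicate k (c + Suc j))"
  have "i \<le> x \<Longrightarrow> rec_nat (list_encode ys) (\<lambda>i r. ncons (nreplicate k (c + (x - i)) 0) r) i
    = list_encode (map ?f [x - i..<x] @ ys)" for i
  proof (induction i)
    case (Suc i)
    then have "[x - Suc i..<x] = (x - Suc i) # [x - i..<x]" and x: "x - i = Suc (x - Suc i)"
      by (simp_all add: upt_conv_Cons Suc_diff_Suc)
    then have "map ?f [x - Suc i..<x] = list_encode (replicate k (c + (x - i))) # map ?f [x - i..<x]"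
      by (simp del: upt_Suc)
    moreover have "nreplicate k (c + (x - i)) 0 = list_encode (replicate k (c + (x - i)))"
      using nreplicate[of k "c + (x - i)" "[]"] by simp
    ultimately show ?case
      using Suc by (simp add: list_encode_Cons del: list_encode.simps(2))
  qed simp
  from this[of x] show ?thesis by (simp add: nchain_def)
qed

definition field_of :: "nat \<Rightarrow> nat \<Rightarrow> nat" where
  "field_of i u = nhd (ndrop i u)"

lemma field_of: "i < length xs \<Longrightarrow> field_of i (list_encode xs) = xs ! i"
  by (simp add: field_of_def ndrop nhd_list_encode_drop)

text \<open>The lists are stored in reverse, so that \<open>nrevapp\<close> can put them in front of the chain.\<close>
definition base_code :: "instr list \<Rightarrow> nat" where
  "base_code P = list_encode [length (state_list P), list_encode [enc P Acc], list_encode [enc P LA, enc P LC],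
     length (msg_list P),
     list_encode (rev (map (\<lambda>s. num P (send (allregs P) 0 s)) (state_list P))),
     list_encode (rev (map list_encode (map (row P) (state_list P)))),
     num P (Some (Cf None {0})), list_encode (replicate (length (syms P)) (enc P idle))]"

text \<open>Arithmetic counterpart of \<open>cell_oca\<close>: the fields of \<open>u\<close> supply
  the base states and the chain for \<open>x\<close> is inserted. It makes sense for every number
  \<open>u\<close>, so both arguments may be the same.\<close>

definition hardwire :: "nat \<Rightarrow> nat \<Rightarrow> nat" where
  "hardwire u x = ncons (field_of 0 u + Suc x) (ncons (field_of 1 u) (ncons (field_of 2 u)
     (ncons (field_of 3 u)
       (ncons (nrevapp (field_of 0 u) (field_of 4 u) (nreplicate x 0 (ncons (field_of 6 u) 0)))
         (ncons (nrevapp (field_of 0 u) (field_of 5 u)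
           (nchain (Suc (Suc (field_of 3 u))) (field_of 0 u) x (ncons (field_of 7 u) 0))) 0)))))"

lemma hardwire_base_code: "hardwire (base_code P) x = oca_code (cell_oca P x)"
proof -
  let ?u = "base_code P"
  have single: "ncons a 0 = list_encode [a]" for a by (simp add: ncons_def)
  have f: "field_of 0 ?u = length (state_list P)" "field_of 1 ?u = list_encode [enc P Acc]"
    "field_of 2 ?u = list_encode [enc P LA, enc P LC]" "field_of 3 ?u = length (msg_list P)"
    "field_of 4 ?u = list_encode (rev (map (\<lambda>s. num P (send (allregs P) 0 s)) (state_list P)))"
    "field_of 5 ?u = list_encode (rev (map list_encode (map (row P) (state_list P))))"
    "field_of 6 ?u = num P (Some (Cf None {0}))"
    "field_of 7 ?u = list_encode (replicate (length (syms P)) (enc P idle))"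
    unfolding base_code_def by (subst field_of; simp)+
  have "nrevapp (field_of 0 ?u) (field_of 4 ?u) (nreplicate x 0 (ncons (field_of 6 ?u) 0))
      = list_encode (bl (cell_oca P x))"
    unfolding f single nreplicate
    using nrevapp[of "map (\<lambda>s. num P (send (allregs P) 0 s)) (state_list P)"]
    by (simp add: cell_oca_def del: list_encode.simps)
  moreover have "nrevapp (field_of 0 ?u) (field_of 5 ?u)
        (nchain (Suc (Suc (field_of 3 ?u))) (field_of 0 ?u) x (ncons (field_of 7 ?u) 0))
      = list_encode (map list_encode (dl (cell_oca P x)))"
    unfolding f single nchain
    using nrevapp[of "map list_encode (map (row P) (state_list P))"]
    by (simp add: cell_oca_def length_syms comp_def del: list_encode.simps replicate_Suc)
  ultimately show ?thesis
    unfolding hardwire_def oca_code_def list_encode_Cons by (simp add: f cell_oca_def del: One_nat_def)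
qed

lemma recfun_hardwire:
  assumes "recfun n U" "recfun n X" shows "recfun n (\<lambda>xs. hardwire (U xs) (X xs))"
  unfolding hardwire_def field_of_def
  by (intro recfun_ncons recfun_nrevapp recfun_nchain recfun_nreplicate recfun_nhd recfun_ndrop
      recfun_add recfun_Suc recfun_const assms)

lemma not_emptiness_decidable:
  assumes "\<And>P x. C (cell_oca P x)"
  shows "\<not> emptiness_decidable C"
proof
  assume "emptiness_decidable C"
  then obtain f where f: "\<And>M. wf_oca M \<Longrightarrow> C M \<Longrightarrow> eval f [oca_code M] (if lang M = {} then 1 else 0)"
    unfolding emptiness_decidable_def by blast
  have "recfun 1 (\<lambda>xs. hardwire (xs ! 0) (xs ! 0))"
    by (intro recfun_hardwire recfun_proj) simp_all
  then obtain h where h: "\<And>xs. length xs = 1 \<Longrightarrow> eval h xs (hardwire (xs ! 0) (xs ! 0))"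
    unfolding recfun_def by blast
  \<comment> \<open>\<open>P\<close> halts on \<open>x\<close> exactly if the supposed decision
    procedure, asked about \<open>hardwire x x\<close>, answers that the language is empty, provided
    it answers.\<close>
  obtain P where P: "\<And>x v. eval (Comp f [h]) [x] v \<Longrightarrow> halts P x \<longleftrightarrow> v \<noteq> 0"
    using compile_recf by blast
  \<comment> \<open>Self-application: \<open>hardwire u u\<close> codes the automaton simulating
    \<open>P\<close> on \<open>u\<close>, whose language is nonempty iff \<open>P\<close> halts
    there; by the choice of \<open>P\<close> this holds iff the language is empty.\<close>
  define u where "u = base_code P"
  define M where "M = cell_oca P u"
  have "eval h [u] (oca_code M)"
    using h[of "[u]"] hardwire_base_code[of P u] by (simp add: u_def M_def)
  moreover have "eval f [oca_code M] (if lang M = {} then 1 else 0)"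
    unfolding M_def by (intro f wf_cell_oca assms)
  ultimately have "eval (Comp f [h]) [u] (if lang M = {} then 1 else 0)"
    by (intro eval_Comp[where ys = "[oca_code M]"]) auto
  from P[OF this] show False
    using lang_cell_oca_empty_iff[of P u] by (auto simp: M_def split: if_splits)
qed

theorem theorem1:
  shows "\<not> emptiness_decidable
            (\<lambda>M. real_time M \<and> sum_com_linear M \<and> bounded_lang (inp M) (lang M))
       \<and> \<not> emptiness_decidable
            (\<lambda>M. real_time M \<and> max_com_log M \<and> bounded_lang (inp M) (lang M))"
  by (intro conjI not_emptiness_decidable real_time_cell_oca bounded_lang_cell_oca
    sum_com_linear_cell_oca max_com_log_cell_oca)

end
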